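(* Let $\{\mathcal{A}_n\mid n\ge 0\}$ be a multiplicity-free family of algebras over a field $\Bbbk$ and let $(J_n\mid n\in\mathbb{N})$ be a JM-sequence in it. Let $n\ge1$. Given any $\mathsf T\in\operatorname{Tab}(n)$, the content $c_{\mathsf T}(n)$ depends only on $\operatorname{type}(\mathsf T)$ and $\operatorname{type}(\overline{\mathsf T})$. In particular, the polynomial $P_{\mathsf T}(J_n)$ depends only on $\operatorname{type}(\mathsf T)$ and $\operatorname{type}(\overline{\mathsf T})$. (That is, if $\mathsf T,\mathsf T'\in\operatorname{Tab}(n)$ satisfy $\operatorname{type}(\mathsf T)=\operatorname{type}(\mathsf T')$ and $\operatorname{type}(\overline{\mathsf T})=\operatorname{type}(\overline{\mathsf T'})$, then $c_{\mathsf T}(n)=c_{\mathsf T'}(n)$ and $P_{\mathsf T}=P_{\mathsf T'}$ as polynomials in $J_n$.)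
   Context: All algebras are finite-dimensional, associative and unital. A finite-dimensional algebra over $\Bbbk$ is split semisimple if it is isomorphic to a direct sum of matrix algebras over $\Bbbk$. A multiplicity-free family of algebras over $\Bbbk$ is a family $\{\mathcal{A}_n\mid n\ge 0\}$ of finite-dimensional split semisimple $\Bbbk$-algebras such that: (a) $\mathcal{A}_0\cong\Bbbk$; (b) for each $n$ there is a unity-preserving algebra embedding $\mathcal{A}_n\hookrightarrow\mathcal{A}_{n+1}$ (by which $\mathcal{A}_n$ is regarded as a subalgebra of $\mathcal{A}_{n+1}$); (c) the restriction to $\mathcal{A}_{n-1}$ of any irreducible $\mathcal{A}_n$-module is isomorphic to a direct sum of pairwise non-isomorphic irreducible $\mathcal{A}_{n-1}$-modules. $\operatorname{Irr}(n)$ is the set of isomorphism classes of irreducible left $\mathcal{A}_n$-modules, and $V^\lambda$ is a representative of $\lambda\in\operatorname{Irr}(n)$. For $\lambda\in\operatorname{Irr}(n)$, $\varepsilon(\lambda)\in Z(\mathcal{A}_n)$ is the primitive central idempotent of $\mathcal{A}_n$ acting as the identity on $V^\lambda$ and as zero on $V^{\lambda'}$ for $\lambda\ne\lambda'\in\operatorname{Irr}(n)$. The branching graph has vertex set $\bigsqcup_{n\ge0}\operatorname{Irr}(n)$, with an edge $\mu\to\lambda$ ($\mu\in\operatorname{Irr}(n-1)$, $\lambda\in\operatorname{Irr}(n)$) if and only if $V^\mu$ is isomorphic to a direct summand of the restriction of $V^\lambda$ to $\mathcal{A}_{n-1}$. $\operatorname{Tab}(n)$ is the set of paths $\mathsf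 T=(\lambda_0\to\lambda_1\to\cdots\to\lambda_n)$ in the branching graph starting at the unique element $\lambda_0=\varnothing$ of $\operatorname{Irr}(0)$, with $\lambda_k\in\operatorname{Irr}(k)$; $\operatorname{type}(\mathsf T)=\lambda_n$, and $\overline{\mathsf T}\in\operatorname{Tab}(n-1)$ is obtained from $\mathsf T$ by deleting its last edge. Set $\varepsilon_{\mathsf T}=\varepsilon(\lambda_1)\cdots\varepsilon(\lambda_n)\in\mathcal{A}_n$ (equal to $1$ if $n=0$). For $n\ge1$, $\mathcal{X}_n$ is the (commutative) subalgebra of $\mathcal{A}_n$ generated by $Z(\mathcal{A}_1),\dots,Z(\mathcal{A}_n)$; $\{\varepsilon_{\mathsf T}\mid\mathsf T\in\operatorname{Tab}(n)\}$ is a $\Bbbk$-basis of $\mathcal{X}_n$, and $\mathcal{X}_1\subset\mathcal{X}_2\subset\cdots$. A sequence $(J_n\mid n\in\mathbb{N})$, $\mathbb{N}=\{1,2,\dots\}$, with $J_n\in\mathcal{X}_n$ for all $n$, is additively central if $J_1+\cdots+J_n\in Z(\mathcal{A}_n)$ for all $n\in\mathbb{N}$; it is separating if $\mathcal{X}_n=\langle J_1,\dots,J_n\rangle$ (the subalgebra generated) for all $n\in\mathbb{N}$; it is a JM-sequence (Jucys--Murphy sequence) if it is both. For $\mathsf T\in\operatorname{Tab}(n)$ and $1\le k\le n$ the scalars (contents) $c_{\mathsf T}(k)\in\Bbbk$ are defined by $J_k=\sum_{\mathsf T\in\operatorname{Tab}(n)}c_{\mathsf T}(k)\,\varepsilon_{\mathsf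 T}$. For $\mathsf T\in\operatorname{Tab}(n)$, $$P_{\mathsf T}(J_n)=\prod_{\substack{\mathsf S\in\operatorname{Tab}(n)\\ \mathsf S\ne\mathsf T,\ \overline{\mathsf S}=\overline{\mathsf T}}}\frac{J_n-c_{\mathsf S}(n)}{c_{\mathsf T}(n)-c_{\mathsf S}(n)}$$ (the denominators are nonzero for a separating sequence). *)

theory Defs
  imports
    "HOL-Library.FuncSet"
    "HOL-Computational_Algebra.Polynomial"
    "HOL-Algebra.AbelCoset"
    "HOL-Algebra.Module"
    "Jordan_Normal_Form.Matrix"
begin

section \<open>Algebras over a field\<close>

text \<open>
  All algebras of a family are realised as unital subalgebras of one ambient algebra, so the
  embeddings are inclusions. For a family given by abstract embeddings the ambient algebra is
  the direct limit.
\<close>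

locale ambient_algebra = vector_space scale
  for scale :: "'k::field \<Rightarrow> 'a::ring_1 \<Rightarrow> 'a" +
  assumes scale_mult_left: "scale c x * y = scale c (x * y)"
    and scale_mult_right: "x * scale c y = scale c (x * y)"

definition subalgebra_over :: "('k::field \<Rightarrow> 'a::ring_1 \<Rightarrow> 'a) \<Rightarrow> 'a set \<Rightarrow> bool" where
  "subalgebra_over scale S \<longleftrightarrow>
     Modules.module.subspace scale S \<and> 1 \<in> S \<and> (\<forall>x\<in>S. \<forall>y\<in>S. x * y \<in> S)"

definition generated_subalgebra :: "('k::field \<Rightarrow> 'a::ring_1 \<Rightarrow> 'a) \<Rightarrow> 'a set \<Rightarrow> 'a set" where
  "generated_subalgebra scale G = subalgebra_over scale hull G"

definition finite_dimensional_subspace :: "('k::field \<Rightarrow> 'a::ring_1 \<Rightarrow> 'a) \<Rightarrow> 'a set \<Rightarrow> bool" where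
  "finite_dimensional_subspace scale S \<longleftrightarrow> (\<exists>B. finite B \<and> S = Modules.module.span scale B)"

definition center :: "'a::ring_1 set \<Rightarrow> 'a set" where
  "center S = {z \<in> S. \<forall>a\<in>S. z * a = a * z}"

definition isomorphic_to_field :: "('k::field \<Rightarrow> 'a::ring_1 \<Rightarrow> 'a) \<Rightarrow> 'a set \<Rightarrow> bool" where
  "isomorphic_to_field scale S \<longleftrightarrow>
     (\<exists>\<phi> :: 'a \<Rightarrow> 'k. bij_betw \<phi> S UNIV \<and> \<phi> 1 = 1 \<and>
        (\<forall>x\<in>S. \<forall>y\<in>S. \<phi> (x + y) = \<phi> x + \<phi> y \<and> \<phi> (x * y) = \<phi> x * \<phi> y) \<and>
        (\<forall>c. \<forall>x\<in>S. \<phi> (scale c x) = c * \<phi> x))"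

text \<open>
  An element of the direct sum of the matrix algebras of sizes \<open>d 0, \<dots>, d (r - 1)\<close> is the family
  of its components; the algebra operations are componentwise.
\<close>

definition split_semisimple :: "('k::field \<Rightarrow> 'a::ring_1 \<Rightarrow> 'a) \<Rightarrow> 'a set \<Rightarrow> bool" where
  "split_semisimple scale S \<longleftrightarrow>
     (\<exists>(r :: nat) (d :: nat \<Rightarrow> nat) (\<phi> :: 'a \<Rightarrow> nat \<Rightarrow> 'k mat).
        (\<forall>i<r. 0 < d i) \<and>
        bij_betw \<phi> S (\<Pi>\<^sub>E i\<in>{..<r}. carrier_mat (d i) (d i)) \<and>
        (\<forall>i<r. \<phi> 1 i = 1\<^sub>m (d i)) \<and>
        (\<forall>x\<in>S. \<forall>y\<in>S. \<forall>i<r. \<phi> (x + y) i = \<phi> x i + \<phi> y i \<and> \<phi> (x * y) i = \<phi> x i * \<phi> y i) \<and>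
        (\<forall>c. \<forall>x\<in>S. \<forall>i<r. \<phi> (scale c x) i = c \<cdot>\<^sub>m \<phi> x i))"


section \<open>Left modules\<close>

text \<open>
  The locale \<open>module\<close> of \<open>HOL-Algebra\<close> is restricted to commutative rings. As there, the
  fields \<open>mult\<close> and \<open>one\<close> of the module record play no role. Only the action of elements of \<open>S\<close>
  is relevant below, so the restriction of a module to a smaller algebra is the same record,
  regarded over the smaller algebra. The vector space structure of a module is the one induced
  by the scalar multiples of \<open>1 \<in> S\<close>.
\<close>

definition left_module :: "'a::ring_1 set \<Rightarrow> ('a, 'v) module \<Rightarrow> bool" where
  "left_module S M \<longleftrightarrow>
     abelian_group M \<and>
     (\<forall>a\<in>S. \<forall>v\<in>carrier M. a \<odot>\<^bsub>M\<^esub> v \<in> carrier M) \<and>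
     (\<forall>a\<in>S. \<forall>v\<in>carrier M. \<forall>w\<in>carrier M. a \<odot>\<^bsub>M\<^esub> (v \<oplus>\<^bsub>M\<^esub> w) = a \<odot>\<^bsub>M\<^esub> v \<oplus>\<^bsub>M\<^esub> a \<odot>\<^bsub>M\<^esub> w) \<and>
     (\<forall>a\<in>S. \<forall>b\<in>S. \<forall>v\<in>carrier M. (a + b) \<odot>\<^bsub>M\<^esub> v = a \<odot>\<^bsub>M\<^esub> v \<oplus>\<^bsub>M\<^esub> b \<odot>\<^bsub>M\<^esub> v) \<and>
     (\<forall>a\<in>S. \<forall>b\<in>S. \<forall>v\<in>carrier M. (a * b) \<odot>\<^bsub>M\<^esub> v = a \<odot>\<^bsub>M\<^esub> (b \<odot>\<^bsub>M\<^esub> v)) \<and>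
     (\<forall>v\<in>carrier M. 1 \<odot>\<^bsub>M\<^esub> v = v)"

definition left_submodule :: "'a::ring_1 set \<Rightarrow> 'v set \<Rightarrow> ('a, 'v) module \<Rightarrow> bool" where
  "left_submodule S W M \<longleftrightarrow>
     subgroup W (add_monoid M) \<and> (\<forall>a\<in>S. \<forall>w\<in>W. a \<odot>\<^bsub>M\<^esub> w \<in> W)"

definition irreducible_module :: "'a::ring_1 set \<Rightarrow> ('a, 'v) module \<Rightarrow> bool" where
  "irreducible_module S M \<longleftrightarrow>
     left_module S M \<and> carrier M \<noteq> {\<zero>\<^bsub>M\<^esub>} \<and>
     (\<forall>W. left_submodule S W M \<longrightarrow> W = {\<zero>\<^bsub>M\<^esub>} \<or> W = carrier M)"

definition isomorphic_modules ::
    "'a::ring_1 set \<Rightarrow> ('a, 'v) module \<Rightarrow> ('a, 'w) module \<Rightarrow> bool" where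
  "isomorphic_modules S M N \<longleftrightarrow>
     (\<exists>f. bij_betw f (carrier M) (carrier N) \<and>
        (\<forall>v\<in>carrier M. \<forall>w\<in>carrier M. f (v \<oplus>\<^bsub>M\<^esub> w) = f v \<oplus>\<^bsub>N\<^esub> f w) \<and>
        (\<forall>a\<in>S. \<forall>v\<in>carrier M. f (a \<odot>\<^bsub>M\<^esub> v) = a \<odot>\<^bsub>N\<^esub> f v))"

definition direct_sum_module :: "nat \<Rightarrow> (nat \<Rightarrow> ('a, 'v) module) \<Rightarrow> ('a, nat \<Rightarrow> 'v) module" where
  "direct_sum_module r M =
     \<lparr>carrier = (\<Pi>\<^sub>E i\<in>{..<r}. carrier (M i)),
      mult = undefined, one = undefined,
      zero = (\<lambda>i\<in>{..<r}. \<zero>\<^bsub>M i\<^esub>),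
      add = (\<lambda>v w. \<lambda>i\<in>{..<r}. v i \<oplus>\<^bsub>M i\<^esub> w i),
      smult = (\<lambda>a v. \<lambda>i\<in>{..<r}. a \<odot>\<^bsub>M i\<^esub> v i)\<rparr>"

definition isomorphic_to_direct_summand ::
    "'a::ring_1 set \<Rightarrow> ('a, 'v) module \<Rightarrow> ('a, 'w) module \<Rightarrow> bool" where
  "isomorphic_to_direct_summand S N M \<longleftrightarrow>
     (\<exists>W W'. left_submodule S W M \<and> left_submodule S W' M \<and>
        W \<inter> W' = {\<zero>\<^bsub>M\<^esub>} \<and> set_add M W W' = carrier M \<and>
        isomorphic_modules S N (M\<lparr>carrier := W\<rparr>))"

text \<open>
  Isomorphism classes are formed among the modules carried by subsets of the type \<open>'a\<close> of the
  algebra itself. No class is lost: an irreducible module \<open>M\<close> on any type is cyclic, say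
  generated by \<open>v\<close>, and transporting its structure along a section of the surjection
  \<open>a \<mapsto> a \<odot> v\<close> from \<open>S\<close> onto \<open>carrier M\<close> gives an isomorphic module carried by a subset of \<open>S\<close>.
\<close>

definition Irr :: "'a::ring_1 set \<Rightarrow> ('a, 'a) module set set" where
  "Irr S = {M. irreducible_module S M} //
     {(M, N). irreducible_module S M \<and> irreducible_module S N \<and> isomorphic_modules S M N}"

definition irr_rep :: "('a::ring_1, 'a) module set \<Rightarrow> ('a, 'a) module" where
  "irr_rep \<nu> = (SOME M. M \<in> \<nu>)"

definition primitive_central_idempotent :: "'a::ring_1 set \<Rightarrow> 'a \<Rightarrow> bool" where
  "primitive_central_idempotent S e \<longleftrightarrow>
     e \<in> center S \<and> e * e = e \<and> e \<noteq> 0 \<and>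
     \<not> (\<exists>f\<in>center S. \<exists>g\<in>center S. f \<noteq> 0 \<and> g \<noteq> 0 \<and>
          f * f = f \<and> g * g = g \<and> f * g = 0 \<and> e = f + g)"

definition irr_idem :: "'a::ring_1 set \<Rightarrow> ('a, 'a) module set \<Rightarrow> 'a" where
  "irr_idem S \<nu> = (THE e. primitive_central_idempotent S e \<and>
     (\<forall>v\<in>carrier (irr_rep \<nu>). e \<odot>\<^bsub>irr_rep \<nu>\<^esub> v = v) \<and>
     (\<forall>\<nu>'\<in>Irr S. \<nu>' \<noteq> \<nu> \<longrightarrow>
        (\<forall>v\<in>carrier (irr_rep \<nu>'). e \<odot>\<^bsub>irr_rep \<nu>'\<^esub> v = \<zero>\<^bsub>irr_rep \<nu>'\<^esub>)))"


section \<open>Multiplicity-free families\<close>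

locale multiplicity_free_family = ambient_algebra scale
  for scale :: "'k::field \<Rightarrow> 'a::ring_1 \<Rightarrow> 'a" +
  fixes A :: "nat \<Rightarrow> 'a set"
  assumes subalgebra: "subalgebra_over scale (A n)"
    and finite_dimensional: "finite_dimensional_subspace scale (A n)"
    and split_semisimple: "split_semisimple scale (A n)"
    and zeroth: "isomorphic_to_field scale (A 0)"
    and increasing: "A n \<subseteq> A (Suc n)"
    and multiplicity_free:
      "irreducible_module (A (Suc n)) (V :: ('a, 'a) module) \<Longrightarrow>
       \<exists>(r :: nat) (M :: nat \<Rightarrow> ('a, 'a) module).
         (\<forall>i<r. irreducible_module (A n) (M i)) \<and>
         (\<forall>i<r. \<forall>j<r. i \<noteq> j \<longrightarrow> \<not> isomorphic_modules (A n) (M i) (M j)) \<and>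
         isomorphic_modules (A n) V (direct_sum_module r M)"

definition branching_edge ::
    "(nat \<Rightarrow> 'a::ring_1 set) \<Rightarrow> nat \<Rightarrow> ('a, 'a) module set \<Rightarrow> ('a, 'a) module set \<Rightarrow> bool" where
  "branching_edge A n \<mu> \<nu> \<longleftrightarrow>
     \<mu> \<in> Irr (A n) \<and> \<nu> \<in> Irr (A (Suc n)) \<and>
     isomorphic_to_direct_summand (A n) (irr_rep \<mu>) (irr_rep \<nu>)"

text \<open>
  The path \<open>\<lambda>\<^sub>0 \<rightarrow> \<dots> \<rightarrow> \<lambda>\<^sub>n\<close> is the list of its vertices, of length \<open>n + 1\<close>. Deleting its last edge
  is \<open>butlast\<close> and its type is \<open>last\<close>.
\<close>

type_synonym 'a path = "('a, 'a) module set list"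

definition Tab :: "(nat \<Rightarrow> 'a::ring_1 set) \<Rightarrow> nat \<Rightarrow> 'a path set" where
  "Tab A n = {T. length T = Suc n \<and> T ! 0 \<in> Irr (A 0) \<and>
     (\<forall>k<n. branching_edge A k (T ! k) (T ! Suc k))}"

abbreviation path_type :: "'a path \<Rightarrow> ('a, 'a) module set" where
  "path_type T \<equiv> last T"

abbreviation path_trunc :: "'a path \<Rightarrow> 'a path" where
  "path_trunc T \<equiv> butlast T"

definition path_idem :: "(nat \<Rightarrow> 'a::ring_1 set) \<Rightarrow> 'a path \<Rightarrow> 'a" where
  "path_idem A T = prod_list (map (\<lambda>k. irr_idem (A k) (T ! k)) [1..<length T])"

definition GZ_algebra ::
    "('k::field \<Rightarrow> 'a::ring_1 \<Rightarrow> 'a) \<Rightarrow> (nat \<Rightarrow> 'a set) \<Rightarrow> nat \<Rightarrow> 'a set" where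
  "GZ_algebra scale A n = generated_subalgebra scale (\<Union>k\<in>{1..n}. center (A k))"


section \<open>Jucys--Murphy sequences\<close>

text \<open>Sequences are indexed by the positive integers; the value at \<open>0\<close> is ignored.\<close>

definition additively_central :: "(nat \<Rightarrow> 'a::ring_1 set) \<Rightarrow> (nat \<Rightarrow> 'a) \<Rightarrow> bool" where
  "additively_central A J \<longleftrightarrow> (\<forall>n\<ge>1. (\<Sum>k=1..n. J k) \<in> center (A n))"

definition separating ::
    "('k::field \<Rightarrow> 'a::ring_1 \<Rightarrow> 'a) \<Rightarrow> (nat \<Rightarrow> 'a set) \<Rightarrow> (nat \<Rightarrow> 'a) \<Rightarrow> bool" where
  "separating scale A J \<longleftrightarrow>
     (\<forall>n\<ge>1. GZ_algebra scale A n = generated_subalgebra scale (J ` {1..n}))"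

definition JM_sequence ::
    "('k::field \<Rightarrow> 'a::ring_1 \<Rightarrow> 'a) \<Rightarrow> (nat \<Rightarrow> 'a set) \<Rightarrow> (nat \<Rightarrow> 'a) \<Rightarrow> bool" where
  "JM_sequence scale A J \<longleftrightarrow>
     (\<forall>n\<ge>1. J n \<in> GZ_algebra scale A n) \<and> additively_central A J \<and> separating scale A J"

text \<open>
  The content \<open>c\<^sub>T(k)\<close> for \<open>T \<in> Tab A n\<close> and \<open>1 \<le> k \<le> n\<close>: the coefficient at \<open>\<epsilon>\<^sub>T\<close> of \<open>J k\<close> in the
  basis of the \<open>n\<close>-th algebra \<open>GZ_algebra\<close> formed by the idempotents of the paths in \<open>Tab A n\<close>.
\<close>

definition jm_content ::
    "('k::field \<Rightarrow> 'a::ring_1 \<Rightarrow> 'a) \<Rightarrow> (nat \<Rightarrow> 'a set) \<Rightarrow> (nat \<Rightarrow> 'a) \<Rightarrow> nat \<Rightarrow> 'a path \<Rightarrow> nat \<Rightarrow> 'k"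
  where
  "jm_content scale A J n T k =
     (THE c. (\<forall>S. S \<notin> Tab A n \<longrightarrow> c S = 0) \<and>
        J k = (\<Sum>S\<in>Tab A n. scale (c S) (path_idem A S))) T"

definition content_poly ::
    "('k::field \<Rightarrow> 'a::ring_1 \<Rightarrow> 'a) \<Rightarrow> (nat \<Rightarrow> 'a set) \<Rightarrow> (nat \<Rightarrow> 'a) \<Rightarrow> nat \<Rightarrow> 'a path \<Rightarrow> 'k poly"
  where
  "content_poly scale A J n T =
     (\<Prod>S\<in>{S \<in> Tab A n. S \<noteq> T \<and> path_trunc S = path_trunc T}.
        Polynomial.smult (1 / (jm_content scale A J n T n - jm_content scale A J n S n))
          [:- jm_content scale A J n S n, 1:])"

definition eval_poly_in :: "('k::field \<Rightarrow> 'a::ring_1 \<Rightarrow> 'a) \<Rightarrow> 'k poly \<Rightarrow> 'a \<Rightarrow> 'a" where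
  "eval_poly_in scale p x = (\<Sum>i\<le>degree p. scale (coeff p i) (x ^ i))"

end

theory Submission
  imports Defs
begin

text \<open>
  The partial sum \<open>z k = J 1 + \<dots> + J k\<close> is central in \<open>A k\<close>, and a central element of \<open>A k\<close> acts on
  the irreducible module of \<open>\<nu> \<in> Irr (A k)\<close> by a scalar, so \<open>z k * irr_idem (A k) \<nu>\<close> is a multiple of
  \<open>irr_idem (A k) \<nu>\<close>. The idempotent of a path of length \<open>n\<close> contains the factors of its last two
  vertices. As \<open>J n = z n - z (n - 1)\<close>, it is an eigenvector of \<open>J n\<close>, with eigenvalue a difference
  of two scalars, one depending on the type of the path and one on the type of its truncation. This
  eigenvalue is the content (\<open>jm_content_depends_on_types\<close>). The polynomial is a product over the
  siblings of the path, and exchanging its truncation for another of the same type turns them into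
  the siblings of the other path without changing types (\<open>content_poly_depends_on_types\<close>).

  To identify the eigenvalue with the coefficient in \<open>jm_content\<close>, one has to know that the path
  idempotents are nonzero, orthogonal and sum to \<open>1\<close>. Orthogonality and the sum come from the
  corresponding facts on each level, once \<open>branching_edge_if_product_nonzero\<close> discards the sequences
  of vertices that are not paths; nonvanishing is \<open>path_idem_nonzero\<close>, obtained by following a
  vector along the edges.

  The facts on one level are the representation theory of a direct sum of matrix algebras. It is
  derived from a rank one idempotent \<open>f\<close> in each block: the corner \<open>f S f\<close> is one-dimensional, so the
  left ideal \<open>S f\<close> is irreducible, and every irreducible module on which the block acts nontrivially
  is isomorphic to it (\<open>isomorphic_if_same_block\<close>). Hence the classes correspond to the blocks, and
  \<open>irr_idem\<close> is the identity of the block (\<open>irr_idem_eq\<close>).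
\<close>

section \<open>Modules over a unital subalgebra\<close>

definition annihilates :: "('a::ring_1, 'v) module \<Rightarrow> 'a \<Rightarrow> bool" where
  "annihilates M x \<longleftrightarrow> (\<forall>v\<in>carrier M. x \<odot>\<^bsub>M\<^esub> v = \<zero>\<^bsub>M\<^esub>)"

definition fixes_pointwise :: "('a::ring_1, 'v) module \<Rightarrow> 'a \<Rightarrow> bool" where
  "fixes_pointwise M x \<longleftrightarrow> (\<forall>v\<in>carrier M. x \<odot>\<^bsub>M\<^esub> v = v)"

lemma left_moduleD:
  assumes "left_module S M"
  shows "abelian_group M"
    and "\<lbrakk>a \<in> S; v \<in> carrier M\<rbrakk> \<Longrightarrow> a \<odot>\<^bsub>M\<^esub> v \<in> carrier M"
    and "\<lbrakk>a \<in> S; v \<in> carrier M; w \<in> carrier M\<rbrakk> \<Longrightarrow>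
      a \<odot>\<^bsub>M\<^esub> (v \<oplus>\<^bsub>M\<^esub> w) = a \<odot>\<^bsub>M\<^esub> v \<oplus>\<^bsub>M\<^esub> a \<odot>\<^bsub>M\<^esub> w"
    and "\<lbrakk>a \<in> S; b \<in> S; v \<in> carrier M\<rbrakk> \<Longrightarrow> (a + b) \<odot>\<^bsub>M\<^esub> v = a \<odot>\<^bsub>M\<^esub> v \<oplus>\<^bsub>M\<^esub> b \<odot>\<^bsub>M\<^esub> v"
    and "\<lbrakk>a \<in> S; b \<in> S; v \<in> carrier M\<rbrakk> \<Longrightarrow> (a * b) \<odot>\<^bsub>M\<^esub> v = a \<odot>\<^bsub>M\<^esub> (b \<odot>\<^bsub>M\<^esub> v)"
    and "v \<in> carrier M \<Longrightarrow> 1 \<odot>\<^bsub>M\<^esub> v = v"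
  using assms unfolding left_module_def by simp_all

lemma left_submodule_subset: "left_submodule S W M \<Longrightarrow> W \<subseteq> carrier M"
  unfolding left_submodule_def using subgroup.subset by fastforce

lemma left_submodule_zero: "left_submodule S W M \<Longrightarrow> \<zero>\<^bsub>M\<^esub> \<in> W"
  unfolding left_submodule_def using subgroup.one_closed by fastforce

lemma left_submodule_add:
  "\<lbrakk>left_submodule S W M; v \<in> W; w \<in> W\<rbrakk> \<Longrightarrow> v \<oplus>\<^bsub>M\<^esub> w \<in> W"
  unfolding left_submodule_def using subgroup.m_closed by fastforce

lemma left_submodule_smult: "\<lbrakk>left_submodule S W M; a \<in> S; w \<in> W\<rbrakk> \<Longrightarrow> a \<odot>\<^bsub>M\<^esub> w \<in> W"
  unfolding left_submodule_def by blast

lemma irreducible_module_nonzero: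
  assumes "irreducible_module S M"
  obtains v where "v \<in> carrier M" "v \<noteq> \<zero>\<^bsub>M\<^esub>"
proof -
  interpret abelian_group M
    using assms unfolding irreducible_module_def left_module_def by blast
  show ?thesis
    using assms zero_closed that unfolding irreducible_module_def by blast
qed

lemma irreducible_module_left_module: "irreducible_module S M \<Longrightarrow> left_module S M"
  unfolding irreducible_module_def by blast

lemma isomorphic_modules_refl: "isomorphic_modules S M M"
  unfolding isomorphic_modules_def by (rule exI[of _ id]) auto

lemma isomorphic_modules_trans:
  assumes "isomorphic_modules S L M" "isomorphic_modules S M N"
  shows "isomorphic_modules S L N"
proof -
  obtain f where f: "bij_betw f (carrier L) (carrier M)"
     "\<And>v w. v\<in>carrier L \<Longrightarrow> w\<in>carrier L \<Longrightarrow> f (v \<oplus>\<^bsub>L\<^esub> w) = f v \<oplus>\<^bsub>M\<^esub> f w"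
     "\<And>a v. a\<in>S \<Longrightarrow> v\<in>carrier L \<Longrightarrow> f (a \<odot>\<^bsub>L\<^esub> v) = a \<odot>\<^bsub>M\<^esub> f v"
    using assms(1) unfolding isomorphic_modules_def by blast
  obtain g where g: "bij_betw g (carrier M) (carrier N)"
     "\<And>v w. v\<in>carrier M \<Longrightarrow> w\<in>carrier M \<Longrightarrow> g (v \<oplus>\<^bsub>M\<^esub> w) = g v \<oplus>\<^bsub>N\<^esub> g w"
     "\<And>a v. a\<in>S \<Longrightarrow> v\<in>carrier M \<Longrightarrow> g (a \<odot>\<^bsub>M\<^esub> v) = a \<odot>\<^bsub>N\<^esub> g v"
    using assms(2) unfolding isomorphic_modules_def by blast
  show ?thesis
    unfolding isomorphic_modules_def
    by (rule exI[of _ "g \<circ> f"])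
      (use f g bij_betw_trans[OF f(1) g(1)] bij_betwE[OF f(1)] in auto)
qed

text \<open>
  The hypotheses are closure conditions rather than \<open>left_module S M\<close>, so that the rule applies
  directly to a submodule presented by restricting the carrier.
\<close>

lemma isomorphic_modules_sym:
  assumes "isomorphic_modules S M N"
    and add: "\<And>v w. v \<in> carrier M \<Longrightarrow> w \<in> carrier M \<Longrightarrow> v \<oplus>\<^bsub>M\<^esub> w \<in> carrier M"
    and smult: "\<And>a v. a \<in> S \<Longrightarrow> v \<in> carrier M \<Longrightarrow> a \<odot>\<^bsub>M\<^esub> v \<in> carrier M"
  shows "isomorphic_modules S N M"
proof -
  obtain f where f: "bij_betw f (carrier M) (carrier N)"
     "\<And>v w. v\<in>carrier M \<Longrightarrow> w\<in>carrier M \<Longrightarrow> f (v \<oplus>\<^bsub>M\<^esub> w) = f v \<oplus>\<^bsub>N\<^esub> f w"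
     "\<And>a v. a\<in>S \<Longrightarrow> v\<in>carrier M \<Longrightarrow> f (a \<odot>\<^bsub>M\<^esub> v) = a \<odot>\<^bsub>N\<^esub> f v"
    using assms(1) unfolding isomorphic_modules_def by blast
  define g where "g = inv_into (carrier M) f"
  have g: "bij_betw g (carrier N) (carrier M)"
    unfolding g_def by (rule bij_betw_inv_into[OF f(1)])
  have fg: "f (g v) = v" if "v \<in> carrier N" for v
    unfolding g_def using bij_betw_inv_into_right[OF f(1) that] .
  have gf: "g (f v) = v" if "v \<in> carrier M" for v
    unfolding g_def using bij_betw_inv_into_left[OF f(1) that] .
  have gin: "g v \<in> carrier M" if "v \<in> carrier N" for v
    using bij_betwE[OF g] that by blast
  show ?thesis
    unfolding isomorphic_modules_def
  proof (intro exI[of _ g] conjI ballI g)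
    fix v w assume "v \<in> carrier N" "w \<in> carrier N"
    then show "g (v \<oplus>\<^bsub>N\<^esub> w) = g v \<oplus>\<^bsub>M\<^esub> g w"
      by (metis add f(2) fg gf gin)
  next
    fix a v assume "a \<in> S" "v \<in> carrier N"
    then show "g (a \<odot>\<^bsub>N\<^esub> v) = a \<odot>\<^bsub>M\<^esub> g v"
      by (metis smult f(3) fg gf gin)
  qed
qed

lemma irreducible_isomorphic_sym:
  assumes "isomorphic_modules S M N" "irreducible_module S M"
  shows "isomorphic_modules S N M"
proof -
  have M: "left_module S M"
    by (rule irreducible_module_left_module[OF assms(2)])
  interpret abelian_group M by (rule left_moduleD(1)[OF M])
  show ?thesis
    by (rule isomorphic_modules_sym[OF assms(1)]) (auto simp: left_moduleD(2)[OF M])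
qed

lemma additive_map_zero:
  assumes "abelian_group M" "abelian_group N"
    and f: "\<And>v. v \<in> carrier M \<Longrightarrow> f v \<in> carrier N"
     "\<And>v w. v\<in>carrier M \<Longrightarrow> w\<in>carrier M \<Longrightarrow> f (v \<oplus>\<^bsub>M\<^esub> w) = f v \<oplus>\<^bsub>N\<^esub> f w"
  shows "f \<zero>\<^bsub>M\<^esub> = \<zero>\<^bsub>N\<^esub>"
proof -
  interpret M: abelian_group M by fact
  interpret N: abelian_group N by fact
  have "f \<zero>\<^bsub>M\<^esub> \<oplus>\<^bsub>N\<^esub> f \<zero>\<^bsub>M\<^esub> = f \<zero>\<^bsub>M\<^esub>"
    using f(2)[of "\<zero>\<^bsub>M\<^esub>" "\<zero>\<^bsub>M\<^esub>"] by simp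
  then show ?thesis
    using f(1)[OF M.zero_closed] by (simp add: N.add.l_cancel_one)
qed

lemma isomorphic_modules_fixes_pointwise:
  assumes "isomorphic_modules S M N" "x \<in> S" "fixes_pointwise M x"
  shows "fixes_pointwise N x"
proof -
  obtain f where f: "bij_betw f (carrier M) (carrier N)"
     "\<And>a v. a\<in>S \<Longrightarrow> v\<in>carrier M \<Longrightarrow> f (a \<odot>\<^bsub>M\<^esub> v) = a \<odot>\<^bsub>N\<^esub> f v"
    using assms(1) unfolding isomorphic_modules_def by blast
  show ?thesis
    unfolding fixes_pointwise_def
  proof
    fix w assume "w \<in> carrier N"
    then obtain v where "v \<in> carrier M" "w = f v"
      using f(1) by (auto simp: bij_betw_def)
    then show "x \<odot>\<^bsub>N\<^esub> w = w"
      using assms f(2)[of x v] by (simp add: fixes_pointwise_def)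
  qed
qed

lemma isomorphic_modules_annihilates:
  assumes "isomorphic_modules S M N" "abelian_group M" "abelian_group N"
    "x \<in> S" "annihilates M x"
  shows "annihilates N x"
proof -
  obtain f where f: "bij_betw f (carrier M) (carrier N)"
     "\<And>v w. v\<in>carrier M \<Longrightarrow> w\<in>carrier M \<Longrightarrow> f (v \<oplus>\<^bsub>M\<^esub> w) = f v \<oplus>\<^bsub>N\<^esub> f w"
     "\<And>a v. a\<in>S \<Longrightarrow> v\<in>carrier M \<Longrightarrow> f (a \<odot>\<^bsub>M\<^esub> v) = a \<odot>\<^bsub>N\<^esub> f v"
    using assms(1) unfolding isomorphic_modules_def by blast
  have f0: "f \<zero>\<^bsub>M\<^esub> = \<zero>\<^bsub>N\<^esub>"
    by (rule additive_map_zero[OF assms(2,3)]) (use f(2) bij_betwE[OF f(1)] in auto)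
  show ?thesis
    unfolding annihilates_def
  proof
    fix w assume "w \<in> carrier N"
    then obtain v where "v \<in> carrier M" "w = f v"
      using f(1) by (auto simp: bij_betw_def)
    then show "x \<odot>\<^bsub>N\<^esub> w = \<zero>\<^bsub>N\<^esub>"
      using assms f(3)[of x v] f0 by (simp add: annihilates_def)
  qed
qed

locale unital_subalgebra = ambient_algebra scale
  for scale :: "'k::field \<Rightarrow> 'a::ring_1 \<Rightarrow> 'a" +
  fixes S :: "'a set"
  assumes subalgebra: "subalgebra_over scale S"
begin

lemma closed [simp]:
  shows "1 \<in> S" "0 \<in> S" "x \<in> S \<Longrightarrow> y \<in> S \<Longrightarrow> x + y \<in> S" "x \<in> S \<Longrightarrow> y \<in> S \<Longrightarrow> x * y \<in> S"
    "x \<in> S \<Longrightarrow> scale c x \<in> S" "x \<in> S \<Longrightarrow> - x \<in> S" "x \<in> S \<Longrightarrow> y \<in> S \<Longrightarrow> x - y \<in> S"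
    "(\<And>i. i \<in> I \<Longrightarrow> g i \<in> S) \<Longrightarrow> sum g I \<in> S"
  using subalgebra unfolding subalgebra_over_def
  by (auto simp: subspace_0 subspace_add subspace_scale subspace_neg subspace_diff subspace_sum)

lemma zero_smult:
  assumes M: "left_module S M" and v: "v \<in> carrier M"
  shows "0 \<odot>\<^bsub>M\<^esub> v = \<zero>\<^bsub>M\<^esub>"
proof -
  interpret abelian_group M by (rule left_moduleD(1)[OF M])
  have "0 \<odot>\<^bsub>M\<^esub> v \<oplus>\<^bsub>M\<^esub> 0 \<odot>\<^bsub>M\<^esub> v = 0 \<odot>\<^bsub>M\<^esub> v"
    using left_moduleD(4)[OF M closed(2) closed(2) v] by simp
  then show ?thesis
    using left_moduleD(2)[OF M closed(2) v] by (simp add: add.l_cancel_one)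
qed

lemma smult_zero:
  assumes M: "left_module S M" and a: "a \<in> S"
  shows "a \<odot>\<^bsub>M\<^esub> \<zero>\<^bsub>M\<^esub> = \<zero>\<^bsub>M\<^esub>"
proof -
  interpret abelian_group M by (rule left_moduleD(1)[OF M])
  have "a \<odot>\<^bsub>M\<^esub> \<zero>\<^bsub>M\<^esub> \<oplus>\<^bsub>M\<^esub> a \<odot>\<^bsub>M\<^esub> \<zero>\<^bsub>M\<^esub> = a \<odot>\<^bsub>M\<^esub> \<zero>\<^bsub>M\<^esub>"
    using left_moduleD(3)[OF M a zero_closed zero_closed] by simp
  then show ?thesis
    using left_moduleD(2)[OF M a zero_closed] by (simp add: add.l_cancel_one)
qed

lemma minus_smult:
  assumes M: "left_module S M" and v: "v \<in> carrier M" and x: "x \<in> S"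
  shows "(- x) \<odot>\<^bsub>M\<^esub> v = \<ominus>\<^bsub>M\<^esub> (x \<odot>\<^bsub>M\<^esub> v)"
proof -
  interpret abelian_group M by (rule left_moduleD(1)[OF M])
  have "(- x) \<odot>\<^bsub>M\<^esub> v \<oplus>\<^bsub>M\<^esub> x \<odot>\<^bsub>M\<^esub> v = \<zero>\<^bsub>M\<^esub>"
    using left_moduleD(4)[OF M closed(6)[OF x] x v] zero_smult[OF M v] by simp
  then show ?thesis
    using left_moduleD(2)[OF M _ v] x by (simp add: minus_equality)
qed

lemma annihilates_sum:
  assumes M: "left_module S M" and "finite I"
    and "\<And>i. i \<in> I \<Longrightarrow> g i \<in> S" "\<And>i. i \<in> I \<Longrightarrow> annihilates M (g i)"
  shows "annihilates M (\<Sum>i\<in>I. g i)"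
proof -
  interpret abelian_group M by (rule left_moduleD(1)[OF M])
  show ?thesis
    using assms(2-)
  proof (induction I rule: finite_induct)
    case empty
    then show ?case by (simp add: annihilates_def zero_smult[OF M])
  next
    case (insert i I)
    then show ?case
      by (auto simp: annihilates_def left_moduleD(4)[OF M])
  qed
qed

lemma annihilates_mult_right:
  assumes M: "left_module S M" and "x \<in> S" "y \<in> S" "annihilates M x"
  shows "annihilates M (x * y)"
  using assms by (simp add: annihilates_def left_moduleD(2,5)[OF M])

lemma annihilates_mult_left:
  assumes M: "left_module S M" and "x \<in> S" "y \<in> S" "annihilates M y"
  shows "annihilates M (x * y)"
  using assms by (simp add: annihilates_def left_moduleD(2,5)[OF M] smult_zero[OF M])

lemma left_submoduleI:
  assumes M: "left_module S M" and W: "W \<subseteq> carrier M" "\<zero>\<^bsub>M\<^esub> \<in> W"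
    and add: "\<And>v w. v \<in> W \<Longrightarrow> w \<in> W \<Longrightarrow> v \<oplus>\<^bsub>M\<^esub> w \<in> W"
    and smult: "\<And>a w. a \<in> S \<Longrightarrow> w \<in> W \<Longrightarrow> a \<odot>\<^bsub>M\<^esub> w \<in> W"
  shows "left_submodule S W M"
proof -
  interpret abelian_group M by (rule left_moduleD(1)[OF M])
  have "\<ominus>\<^bsub>M\<^esub> w \<in> W" if "w \<in> W" for w
    using minus_smult[OF M, of w 1] left_moduleD(6)[OF M] smult[of "-1" w] that W by auto
  then have "subgroup W (add_monoid M)"
    using W add by (intro add.subgroupI) (auto simp: a_inv_def)
  then show ?thesis
    unfolding left_submodule_def using smult by blast
qed

text \<open>
  The action of a central element commutes with every other action, so its kernel and its fixed
  space are stable.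
\<close>

lemma central_kernel_submodule:
  assumes M: "left_module S M" and z: "z \<in> center S"
  shows "left_submodule S {v \<in> carrier M. z \<odot>\<^bsub>M\<^esub> v = \<zero>\<^bsub>M\<^esub>} M"
proof -
  interpret abelian_group M by (rule left_moduleD(1)[OF M])
  have zS: "z \<in> S" and comm: "\<And>a. a \<in> S \<Longrightarrow> z * a = a * z"
    using z by (auto simp: center_def)
  show ?thesis
  proof (rule left_submoduleI[OF M])
    fix a w assume a: "a \<in> S" and w: "w \<in> {v \<in> carrier M. z \<odot>\<^bsub>M\<^esub> v = \<zero>\<^bsub>M\<^esub>}"
    have "z \<odot>\<^bsub>M\<^esub> (a \<odot>\<^bsub>M\<^esub> w) = a \<odot>\<^bsub>M\<^esub> (z \<odot>\<^bsub>M\<^esub> w)"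
      using left_moduleD(5)[OF M] a w zS comm by (metis (no_types, lifting) mem_Collect_eq)
    then show "a \<odot>\<^bsub>M\<^esub> w \<in> {v \<in> carrier M. z \<odot>\<^bsub>M\<^esub> v = \<zero>\<^bsub>M\<^esub>}"
      using a w left_moduleD(2)[OF M] smult_zero[OF M] by simp
  qed (auto simp: left_moduleD(3)[OF M] zS smult_zero[OF M])
qed

lemma central_fixed_submodule:
  assumes M: "left_module S M" and z: "z \<in> center S"
  shows "left_submodule S {v \<in> carrier M. z \<odot>\<^bsub>M\<^esub> v = v} M"
proof -
  interpret abelian_group M by (rule left_moduleD(1)[OF M])
  have zS: "z \<in> S" and comm: "\<And>a. a \<in> S \<Longrightarrow> z * a = a * z"
    using z by (auto simp: center_def)
  show ?thesis
  proof (rule left_submoduleI[OF M])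
    fix a w assume a: "a \<in> S" and w: "w \<in> {v \<in> carrier M. z \<odot>\<^bsub>M\<^esub> v = v}"
    have "z \<odot>\<^bsub>M\<^esub> (a \<odot>\<^bsub>M\<^esub> w) = a \<odot>\<^bsub>M\<^esub> (z \<odot>\<^bsub>M\<^esub> w)"
      using left_moduleD(5)[OF M] a w zS comm by (metis (no_types, lifting) mem_Collect_eq)
    then show "a \<odot>\<^bsub>M\<^esub> w \<in> {v \<in> carrier M. z \<odot>\<^bsub>M\<^esub> v = v}"
      using a w left_moduleD(2)[OF M] by simp
  qed (auto simp: left_moduleD(3)[OF M] zS smult_zero[OF M])
qed

lemma cyclic_submodule:
  assumes M: "left_module S M" and v: "v \<in> carrier M"
  shows "left_submodule S ((\<lambda>x. x \<odot>\<^bsub>M\<^esub> v) ` S) M"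
proof (rule left_submoduleI[OF M])
  show "\<zero>\<^bsub>M\<^esub> \<in> (\<lambda>x. x \<odot>\<^bsub>M\<^esub> v) ` S"
    using zero_smult[OF M v] by (metis closed(2) image_eqI)
next
  fix w w' assume "w \<in> (\<lambda>x. x \<odot>\<^bsub>M\<^esub> v) ` S" "w' \<in> (\<lambda>x. x \<odot>\<^bsub>M\<^esub> v) ` S"
  then obtain x y where "x \<in> S" "y \<in> S" "w = x \<odot>\<^bsub>M\<^esub> v" "w' = y \<odot>\<^bsub>M\<^esub> v" by blast
  then show "w \<oplus>\<^bsub>M\<^esub> w' \<in> (\<lambda>x. x \<odot>\<^bsub>M\<^esub> v) ` S"
    using left_moduleD(4)[OF M _ _ v] by (intro image_eqI[of _ _ "x + y"]) auto
next
  fix a w assume "a \<in> S" "w \<in> (\<lambda>x. x \<odot>\<^bsub>M\<^esub> v) ` S"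
  then obtain x where "x \<in> S" "w = x \<odot>\<^bsub>M\<^esub> v" "a \<in> S" by blast
  then show "a \<odot>\<^bsub>M\<^esub> w \<in> (\<lambda>x. x \<odot>\<^bsub>M\<^esub> v) ` S"
    using left_moduleD(5)[OF M _ _ v] by (intro image_eqI[of _ _ "a * x"]) auto
qed (use left_moduleD(2)[OF M] v in auto)

lemma irreducible_generated:
  assumes M: "irreducible_module S M" and v: "v \<in> carrier M" "v \<noteq> \<zero>\<^bsub>M\<^esub>"
  shows "carrier M = (\<lambda>x. x \<odot>\<^bsub>M\<^esub> v) ` S"
proof -
  have M': "left_module S M" by (rule irreducible_module_left_module[OF M])
  have "v \<in> (\<lambda>x. x \<odot>\<^bsub>M\<^esub> v) ` S"
    using left_moduleD(6)[OF M' v(1)] by (metis closed(1) image_eqI)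
  then show ?thesis
    using cyclic_submodule[OF M' v(1)] M v(2) unfolding irreducible_module_def by blast
qed

text \<open>
  The kernel of \<open>z\<close> is a submodule, hence everything or zero. In the second case \<open>z\<close> acts
  injectively, and since it annihilates the image of \<open>1 - z\<close>, that image is zero.
\<close>

lemma central_idempotent_action:
  assumes M: "irreducible_module S M" and z: "z \<in> center S" "z * z = z"
  shows "annihilates M z \<or> fixes_pointwise M z"
proof -
  have M': "left_module S M" by (rule irreducible_module_left_module[OF M])
  interpret abelian_group M by (rule left_moduleD(1)[OF M'])
  have zS: "z \<in> S" using z(1) by (auto simp: center_def)
  let ?K = "{v \<in> carrier M. z \<odot>\<^bsub>M\<^esub> v = \<zero>\<^bsub>M\<^esub>}"
  consider "?K = {\<zero>\<^bsub>M\<^esub>}" | "?K = carrier M"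
    using central_kernel_submodule[OF M' z(1)] M unfolding irreducible_module_def by blast
  then show ?thesis
  proof cases
    case 1
    have "z \<odot>\<^bsub>M\<^esub> v = v" if v: "v \<in> carrier M" for v
    proof -
      have "z \<odot>\<^bsub>M\<^esub> ((1 - z) \<odot>\<^bsub>M\<^esub> v) = (z * (1 - z)) \<odot>\<^bsub>M\<^esub> v"
        using left_moduleD(5)[OF M', of z "1 - z" v] zS v by simp
      also have "z * (1 - z) = 0" using z(2) by (simp add: right_diff_distrib)
      finally have "(1 - z) \<odot>\<^bsub>M\<^esub> v \<in> ?K"
        using zero_smult[OF M' v] left_moduleD(2)[OF M' _ v, of "1 - z"] zS by simp
      then have "(1 - z) \<odot>\<^bsub>M\<^esub> v = \<zero>\<^bsub>M\<^esub>" using 1 by blast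
      moreover have "v = z \<odot>\<^bsub>M\<^esub> v \<oplus>\<^bsub>M\<^esub> (1 - z) \<odot>\<^bsub>M\<^esub> v"
        using left_moduleD(4)[OF M', of z "1 - z" v] zS v left_moduleD(6)[OF M' v] by simp
      ultimately show ?thesis using left_moduleD(2)[OF M' zS v] by simp
    qed
    then show ?thesis by (simp add: fixes_pointwise_def)
  next
    case 2
    then show ?thesis unfolding annihilates_def by blast
  qed
qed

lemma not_annihilates_if_fixes:
  assumes "irreducible_module S M" "fixes_pointwise M x"
  shows "\<not> annihilates M x"
  using assms irreducible_module_nonzero[OF assms(1)]
  by (metis annihilates_def fixes_pointwise_def)

section \<open>Isomorphism classes of irreducible modules\<close>

lemma Irr_equiv:
  "equiv {M :: ('a, 'v) module. irreducible_module S M}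
     {(M, N). irreducible_module S M \<and> irreducible_module S N \<and> isomorphic_modules S M N}"
proof (rule equivI)
  show "sym {(M :: ('a, 'v) module, N).
      irreducible_module S M \<and> irreducible_module S N \<and> isomorphic_modules S M N}"
    unfolding sym_def using irreducible_isomorphic_sym by fast
  show "trans {(M :: ('a, 'v) module, N).
      irreducible_module S M \<and> irreducible_module S N \<and> isomorphic_modules S M N}"
    unfolding trans_def using isomorphic_modules_trans by fast
qed (simp_all add: refl_on_def isomorphic_modules_refl subset_iff)

lemma irr_rep_mem:
  assumes "\<nu> \<in> Irr S"
  shows "irr_rep \<nu> \<in> \<nu>"
  using in_quotient_imp_non_empty[OF Irr_equiv assms[unfolded Irr_def]]
  unfolding irr_rep_def by (simp add: some_in_eq)

lemma irr_rep_irreducible: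
  assumes "\<nu> \<in> Irr S"
  shows "irreducible_module S (irr_rep \<nu>)"
  using in_quotient_imp_subset[OF Irr_equiv assms[unfolded Irr_def]] irr_rep_mem[OF assms]
  by blast

lemma Irr_eq_iff:
  assumes "\<nu> \<in> Irr S" "\<nu>' \<in> Irr S"
  shows "\<nu> = \<nu>' \<longleftrightarrow> isomorphic_modules S (irr_rep \<nu>) (irr_rep \<nu>')"
  using quotient_eq_iff[OF Irr_equiv assms[unfolded Irr_def] irr_rep_mem[OF assms(1)]
      irr_rep_mem[OF assms(2)]]
    irr_rep_irreducible assms by auto

lemma irr_rep_exhaustive:
  assumes "irreducible_module S (M :: ('a, 'a) module)"
  obtains \<nu> where "\<nu> \<in> Irr S" "isomorphic_modules S M (irr_rep \<nu>)"
proof -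
  let ?R = "{(M :: ('a, 'a) module, N). irreducible_module S M \<and> irreducible_module S N \<and>
    isomorphic_modules S M N}"
  have "?R `` {M} \<in> Irr S"
    unfolding Irr_def using assms by (intro quotientI) simp
  moreover from irr_rep_mem[OF this] have "isomorphic_modules S M (irr_rep (?R `` {M}))"
    by blast
  ultimately show ?thesis using that by blast
qed

lemma smult_eq_iff_diff:
  assumes M: "left_module S M" and v: "v \<in> carrier M" and x: "x \<in> S" "y \<in> S"
  shows "x \<odot>\<^bsub>M\<^esub> v = y \<odot>\<^bsub>M\<^esub> v \<longleftrightarrow> (x - y) \<odot>\<^bsub>M\<^esub> v = \<zero>\<^bsub>M\<^esub>"
proof -
  interpret abelian_group M by (rule left_moduleD(1)[OF M])
  have "x \<odot>\<^bsub>M\<^esub> v = (x - y) \<odot>\<^bsub>M\<^esub> v \<oplus>\<^bsub>M\<^esub> y \<odot>\<^bsub>M\<^esub> v"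
    using left_moduleD(4)[OF M closed(7)[OF x] x(2) v] by simp
  then show ?thesis
    using left_moduleD(2)[OF M _ v] x by (simp add: add.r_cancel_one)
qed

text \<open>
  Both modules are the quotient of the algebra by the common annihilator of the two generators.
\<close>

lemma isomorphic_if_same_annihilator:
  assumes M: "irreducible_module S M" and N: "irreducible_module S N"
    and v: "v \<in> carrier M" "v \<noteq> \<zero>\<^bsub>M\<^esub>" and w: "w \<in> carrier N" "w \<noteq> \<zero>\<^bsub>N\<^esub>"
    and ann: "\<And>x. x \<in> S \<Longrightarrow> x \<odot>\<^bsub>M\<^esub> v = \<zero>\<^bsub>M\<^esub> \<longleftrightarrow> x \<odot>\<^bsub>N\<^esub> w = \<zero>\<^bsub>N\<^esub>"
  shows "isomorphic_modules S M N"
proof -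
  have M': "left_module S M" and N': "left_module S N"
    using M N by (simp_all add: irreducible_module_left_module)
  have same: "x \<odot>\<^bsub>M\<^esub> v = y \<odot>\<^bsub>M\<^esub> v \<longleftrightarrow> x \<odot>\<^bsub>N\<^esub> w = y \<odot>\<^bsub>N\<^esub> w" if "x \<in> S" "y \<in> S" for x y
    using that ann[of "x - y"] smult_eq_iff_diff[OF M' v(1)] smult_eq_iff_diff[OF N' w(1)]
    by simp
  define g where "g u = (SOME x. x \<in> S \<and> u = x \<odot>\<^bsub>M\<^esub> v) \<odot>\<^bsub>N\<^esub> w" for u
  have g: "g (x \<odot>\<^bsub>M\<^esub> v) = x \<odot>\<^bsub>N\<^esub> w" if x: "x \<in> S" for x
  proof -
    have "\<exists>y. y \<in> S \<and> x \<odot>\<^bsub>M\<^esub> v = y \<odot>\<^bsub>M\<^esub> v" using x by blast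
    from someI_ex[OF this] show ?thesis
      unfolding g_def using same[OF x] by metis
  qed
  have cM: "carrier M = (\<lambda>x. x \<odot>\<^bsub>M\<^esub> v) ` S" by (rule irreducible_generated[OF M v])
  have cN: "carrier N = (\<lambda>x. x \<odot>\<^bsub>N\<^esub> w) ` S" by (rule irreducible_generated[OF N w])
  show ?thesis
    unfolding isomorphic_modules_def
  proof (intro exI[of _ g] conjI ballI)
    show "bij_betw g (carrier M) (carrier N)"
      unfolding bij_betw_def
    proof
      show "inj_on g (carrier M)"
        unfolding cM by (auto simp: inj_on_def g same)
      show "g ` carrier M = carrier N"
        unfolding cM cN image_image by (simp add: g cong: image_cong)
    qed
  next
    fix u u' assume "u \<in> carrier M" "u' \<in> carrier M"
    then obtain x y where xy: "x \<in> S" "y \<in> S" "u = x \<odot>\<^bsub>M\<^esub> v" "u' = y \<odot>\<^bsub>M\<^esub> v"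
      unfolding cM by blast
    then show "g (u \<oplus>\<^bsub>M\<^esub> u') = g u \<oplus>\<^bsub>N\<^esub> g u'"
      using g[of "x + y"]
        by (simp add: g left_moduleD(4)[OF M' _ _ v(1)] left_moduleD(4)[OF N' _ _ w(1)])
  next
    fix a u assume a: "a \<in> S" and "u \<in> carrier M"
    then obtain x where x: "x \<in> S" "u = x \<odot>\<^bsub>M\<^esub> v"
      unfolding cM by blast
    then show "g (a \<odot>\<^bsub>M\<^esub> u) = a \<odot>\<^bsub>N\<^esub> g u"
      using g[of "a * x"] a
        by (simp add: g left_moduleD(5)[OF M' _ _ v(1)] left_moduleD(5)[OF N' _ _ w(1)])
  qed
qed

end

section \<open>Block idempotents and irreducible modules\<close>

text \<open>
  If \<open>f\<close> is a matrix unit on the diagonal of a block, this is a space of columns: the irreducible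
  module of that block, carried by a subset of the algebra.
\<close>

definition left_ideal_module :: "'a::ring_1 set \<Rightarrow> 'a \<Rightarrow> ('a, 'a) module" where
  "left_ideal_module S f = \<lparr>carrier = (\<lambda>x. x * f) ` S, mult = undefined, one = undefined,
     zero = 0, add = (+), smult = (*)\<rparr>"

text \<open>
  The part of the structure of a direct sum of matrix algebras that controls its irreducible
  modules: \<open>e i\<close> is the identity of the \<open>i\<close>-th block and \<open>f i\<close> a rank one idempotent in it. The
  corner of \<open>f i\<close> is one-dimensional, and \<open>f i\<close> generates the block as a two-sided ideal. Sums of
  products with \<open>p i a\<close> and \<open>q i a\<close> carry statements about \<open>f i\<close> over to \<open>e i\<close>; for matrices these
  are the matrix units \<open>E a 0\<close> and \<open>E 0 a\<close>.
\<close>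

locale block_idempotents = unital_subalgebra scale S
  for scale :: "'k::field \<Rightarrow> 'a::ring_1 \<Rightarrow> 'a" and S +
  fixes r :: nat and e f :: "nat \<Rightarrow> 'a" and d :: "nat \<Rightarrow> nat" and p q :: "nat \<Rightarrow> nat \<Rightarrow> 'a"
  assumes e_center: "i < r \<Longrightarrow> e i \<in> center S"
    and e_orthogonal: "i < r \<Longrightarrow> j < r \<Longrightarrow> i \<noteq> j \<Longrightarrow> e i * e j = 0"
    and e_sum: "(\<Sum>i<r. e i) = 1"
    and f_mem: "i < r \<Longrightarrow> f i \<in> S"
    and f_idempotent: "i < r \<Longrightarrow> f i * f i = f i"
    and f_nonzero: "i < r \<Longrightarrow> f i \<noteq> 0"
    and e_f: "i < r \<Longrightarrow> e i * f i = f i"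
    and f_corner: "i < r \<Longrightarrow> x \<in> S \<Longrightarrow> \<exists>c. f i * x * f i = scale c (f i)"
    and p_mem: "i < r \<Longrightarrow> a < d i \<Longrightarrow> p i a \<in> S"
    and q_mem: "i < r \<Longrightarrow> a < d i \<Longrightarrow> q i a \<in> S"
    and e_generated: "i < r \<Longrightarrow> e i = (\<Sum>a<d i. p i a * f i * q i a)"
begin

lemma e_mem: "i < r \<Longrightarrow> e i \<in> S"
  using e_center by (simp add: center_def)

lemma e_commute: "i < r \<Longrightarrow> x \<in> S \<Longrightarrow> e i * x = x * e i"
  using e_center by (simp add: center_def)

lemma mult_sum_e: "x = (\<Sum>i<r. x * e i)"
  using e_sum by (simp flip: sum_distrib_left)

lemma e_idempotent:
  assumes "i < r"
  shows "e i * e i = e i"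
proof -
  have "e i = (\<Sum>j<r. e i * e j)" by (rule mult_sum_e)
  also have "\<dots> = (\<Sum>j\<in>{i}. e i * e j)"
    using assms by (intro sum.mono_neutral_right) (auto intro!: e_orthogonal)
  finally show ?thesis by simp
qed

lemma e_nonzero: "i < r \<Longrightarrow> e i \<noteq> 0"
  using e_f f_nonzero by fastforce

text \<open>
  For central \<open>z\<close> the element \<open>z * f i\<close> lies in the one-dimensional corner of \<open>f i\<close>, and the
  resulting scalar spreads to \<open>e i\<close> because \<open>f i\<close> generates the block.
\<close>

lemma center_scalar:
  assumes i: "i < r" and z: "z \<in> center S"
  shows "\<exists>c. z * e i = scale c (e i)"
proof -
  have zS: "z \<in> S" and comm: "\<And>x. x \<in> S \<Longrightarrow> z * x = x * z"
    using z by (auto simp: center_def)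
  obtain c where c: "f i * z * f i = scale c (f i)"
    using f_corner[OF i zS] by blast
  have zf: "z * f i = scale c (f i)"
    using c comm[OF f_mem[OF i]] f_idempotent[OF i] by (metis mult.assoc)
  have "z * e i = (\<Sum>a<d i. z * (p i a * f i * q i a))"
    by (simp add: e_generated[OF i] sum_distrib_left)
  also have "\<dots> = (\<Sum>a<d i. scale c (p i a * f i * q i a))"
  proof (rule sum.cong[OF refl])
    fix a assume "a \<in> {..<d i}"
    then have "z * p i a = p i a * z" using comm[OF p_mem[OF i]] by simp
    then have "z * (p i a * f i * q i a) = p i a * (z * f i) * q i a"
      by (metis mult.assoc)
    then show "z * (p i a * f i * q i a) = scale c (p i a * f i * q i a)"
      by (simp add: zf scale_mult_left scale_mult_right)
  qed
  also have "\<dots> = scale c (e i)"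
    by (simp add: e_generated[OF i] scale_sum_right)
  finally show ?thesis by blast
qed

text \<open>
  Orthogonal central idempotents with sum \<open>e i\<close> are scalar multiples of \<open>e i\<close>, and the product of
  the two scalars vanishes.
\<close>

lemma e_primitive:
  assumes i: "i < r"
  shows "primitive_central_idempotent S (e i)"
  unfolding primitive_central_idempotent_def
proof (intro conjI notI)
  assume "\<exists>g\<in>center S. \<exists>h\<in>center S. g \<noteq> 0 \<and> h \<noteq> 0 \<and> g * g = g \<and> h * h = h \<and>
    g * h = 0 \<and> e i = g + h"
  then obtain g h where gh: "g \<in> center S" "h \<in> center S" "g \<noteq> 0" "h \<noteq> 0" "g * g = g"
    "h * h = h" "g * h = 0" "e i = g + h" by blast
  have "g \<in> S" using gh(1) by (simp add: center_def)
  then have "h * g = g * h" using gh(2) unfolding center_def by blast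
  then have "h * g = 0" using gh(7) by simp
  have "g * e i = g" "h * e i = h"
    using gh(5-8) \<open>h * g = 0\<close> by (simp_all add: distrib_left)
  then obtain c c' where c: "g = scale c (e i)" "h = scale c' (e i)"
    using center_scalar[OF i gh(1)] center_scalar[OF i gh(2)] by metis
  then have "c = 0 \<or> c' = 0"
    using gh(7) e_nonzero[OF i]
    by (auto simp: scale_mult_left scale_mult_right e_idempotent[OF i])
  then show False using c gh(3,4) by auto
qed (use e_center e_idempotent e_nonzero i in auto)

text \<open>
  Multiplying a nonzero \<open>x * f i\<close> on the left by a suitable \<open>f i * q i a\<close> gives a nonzero element
  of the corner, that is, a nonzero multiple of \<open>f i\<close>. This makes the left ideal irreducible and
  determines all irreducible modules of the block.
\<close>

lemma left_ideal_recovers_generator: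
  assumes i: "i < r" and x: "x \<in> S" "x * f i \<noteq> 0"
  obtains y where "y \<in> S" "y * (x * f i) = f i"
proof -
  have "x * f i = (x * e i) * f i" using e_f[OF i] by (simp add: mult.assoc)
  also have "\<dots> = e i * x * f i" using e_commute[OF i x(1)] by simp
  also have "\<dots> = (\<Sum>a<d i. p i a * f i * q i a * x * f i)"
    by (simp add: e_generated[OF i] sum_distrib_right)
  finally obtain a where a: "a < d i" "p i a * f i * q i a * x * f i \<noteq> 0"
    using x(2) by (metis (no_types, lifting) lessThan_iff sum.neutral)
  have qx: "q i a * x \<in> S" using q_mem[OF i a(1)] x(1) by simp
  obtain c where c: "f i * (q i a * x) * f i = scale c (f i)"
    using f_corner[OF i qx] by blast
  have "p i a * (f i * (q i a * x) * f i) \<noteq> 0" using a(2) by (simp add: mult.assoc)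
  then have "c \<noteq> 0" unfolding c by auto
  have "scale (1 / c) (f i * q i a) * (x * f i) = scale (1 / c) (f i * (q i a * x) * f i)"
    by (simp add: scale_mult_left mult.assoc)
  also have "\<dots> = f i" unfolding c using \<open>c \<noteq> 0\<close> by simp
  finally show ?thesis
    by (intro that[of "scale (1 / c) (f i * q i a)"]) (simp_all add: f_mem[OF i] q_mem[OF i a(1)])
qed

lemma irreducible_block:
  assumes M: "irreducible_module S M"
  obtains i where "i < r" "fixes_pointwise M (e i)"
proof -
  have M': "left_module S M" by (rule irreducible_module_left_module[OF M])
  have "\<exists>i<r. fixes_pointwise M (e i)"
  proof (rule ccontr)
    assume "\<not> ?thesis"
    then have "\<And>i. i < r \<Longrightarrow> annihilates M (e i)"
      using central_idempotent_action[OF M e_center e_idempotent] by blast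
    then have "annihilates M (\<Sum>i<r. e i)"
      by (intro annihilates_sum[OF M']) (auto simp: e_mem)
    then have "annihilates M 1" unfolding e_sum .
    then show False
      using irreducible_module_nonzero[OF M] left_moduleD(6)[OF M']
      unfolding annihilates_def by metis
  qed
  then show ?thesis using that by blast
qed

lemma other_blocks_annihilate:
  assumes M: "left_module S M" and ij: "i < r" "j < r" "i \<noteq> j" and "fixes_pointwise M (e i)"
  shows "annihilates M (e j)"
  unfolding annihilates_def
proof
  fix v assume v: "v \<in> carrier M"
  have "e j \<odot>\<^bsub>M\<^esub> v = e j \<odot>\<^bsub>M\<^esub> (e i \<odot>\<^bsub>M\<^esub> v)"
    using assms v by (simp add: fixes_pointwise_def)
  also have "\<dots> = (e j * e i) \<odot>\<^bsub>M\<^esub> v"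
    using left_moduleD(5)[OF M] ij v e_mem by simp
  also have "\<dots> = \<zero>\<^bsub>M\<^esub>"
    using e_orthogonal ij zero_smult[OF M v] by simp
  finally show "e j \<odot>\<^bsub>M\<^esub> v = \<zero>\<^bsub>M\<^esub>" .
qed

lemma block_vector:
  assumes M: "irreducible_module S M" and i: "i < r" and fixed: "fixes_pointwise M (e i)"
  obtains v where "v \<in> carrier M" "f i \<odot>\<^bsub>M\<^esub> v \<noteq> \<zero>\<^bsub>M\<^esub>"
proof -
  have M': "left_module S M" by (rule irreducible_module_left_module[OF M])
  have "\<not> annihilates M (f i)"
  proof
    assume "annihilates M (f i)"
    then have "annihilates M (e i)"
      unfolding e_generated[OF i]
      by (intro annihilates_sum[OF M'] annihilates_mult_left[OF M'] annihilates_mult_right[OF M'])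
        (auto simp: p_mem q_mem f_mem i)
    then show False
      using not_annihilates_if_fixes[OF M fixed] by blast
  qed
  then show ?thesis using that unfolding annihilates_def by blast
qed

text \<open>
  The annihilator of a nonzero vector \<open>f i v\<close> is the same in every module: a nonzero \<open>x * f i\<close> can
  be multiplied back to \<open>f i\<close>, so it cannot kill \<open>v\<close>.
\<close>

lemma annihilator_block_vector:
  assumes M: "left_module S M" and i: "i < r"
    and v: "v \<in> carrier M" "f i \<odot>\<^bsub>M\<^esub> v \<noteq> \<zero>\<^bsub>M\<^esub>" and x: "x \<in> S"
  shows "x \<odot>\<^bsub>M\<^esub> (f i \<odot>\<^bsub>M\<^esub> v) = \<zero>\<^bsub>M\<^esub> \<longleftrightarrow> x * f i = 0"
proof
  assume "x * f i = 0"
  then show "x \<odot>\<^bsub>M\<^esub> (f i \<odot>\<^bsub>M\<^esub> v) = \<zero>\<^bsub>M\<^esub>"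
    using left_moduleD(5)[OF M x f_mem[OF i] v(1)] zero_smult[OF M v(1)] by simp
next
  assume xv: "x \<odot>\<^bsub>M\<^esub> (f i \<odot>\<^bsub>M\<^esub> v) = \<zero>\<^bsub>M\<^esub>"
  show "x * f i = 0"
  proof (rule ccontr)
    assume "x * f i \<noteq> 0"
    then obtain y where y: "y \<in> S" "y * (x * f i) = f i"
      using left_ideal_recovers_generator[OF i x] by blast
    have "f i \<odot>\<^bsub>M\<^esub> v = y \<odot>\<^bsub>M\<^esub> (x \<odot>\<^bsub>M\<^esub> (f i \<odot>\<^bsub>M\<^esub> v))"
      using left_moduleD(5)[OF M y(1) closed(4)[OF x f_mem[OF i]] v(1)]
        left_moduleD(5)[OF M x f_mem[OF i] v(1)] y(2) by simp
    also have "\<dots> = \<zero>\<^bsub>M\<^esub>" using xv smult_zero[OF M y(1)] by simp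
    finally show False using v(2) by blast
  qed
qed

lemma isomorphic_if_same_block:
  assumes M: "irreducible_module S M" and N: "irreducible_module S N" and i: "i < r"
    and "fixes_pointwise M (e i)" "fixes_pointwise N (e i)"
  shows "isomorphic_modules S M N"
proof -
  have M': "left_module S M" and N': "left_module S N"
    using M N by (simp_all add: irreducible_module_left_module)
  obtain v where v: "v \<in> carrier M" "f i \<odot>\<^bsub>M\<^esub> v \<noteq> \<zero>\<^bsub>M\<^esub>"
    using block_vector[OF M i] assms by blast
  obtain w where w: "w \<in> carrier N" "f i \<odot>\<^bsub>N\<^esub> w \<noteq> \<zero>\<^bsub>N\<^esub>"
    using block_vector[OF N i] assms by blast
  show ?thesis
    by (rule isomorphic_if_same_annihilator[OF M N _ v(2) _ w(2)])
      (simp_all add: annihilator_block_vector[OF M' i v] annihilator_block_vector[OF N' i w]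
        left_moduleD(2)[OF M' f_mem[OF i] v(1)] left_moduleD(2)[OF N' f_mem[OF i] w(1)])
qed

lemma left_ideal_left_module:
  assumes i: "i < r"
  shows "left_module S (left_ideal_module S (f i))"
proof -
  have ab: "abelian_group (left_ideal_module S (f i))"
  proof (rule abelian_groupI)
    fix x y assume "x \<in> carrier (left_ideal_module S (f i))" "y \<in> carrier (left_ideal_module S (f i))"
    then show "x \<oplus>\<^bsub>left_ideal_module S (f i)\<^esub> y \<in> carrier (left_ideal_module S (f i))"
      by (auto simp: left_ideal_module_def simp flip: distrib_right)
  next
    show "\<zero>\<^bsub>left_ideal_module S (f i)\<^esub> \<in> carrier (left_ideal_module S (f i))"
      by (auto simp: left_ideal_module_def intro: image_eqI[of _ _ 0])
  next
    fix x assume "x \<in> carrier (left_ideal_module S (f i))"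
    then obtain a where "a \<in> S" "x = a * f i" by (auto simp: left_ideal_module_def)
    then show "\<exists>y\<in>carrier (left_ideal_module S (f i)).
        y \<oplus>\<^bsub>left_ideal_module S (f i)\<^esub> x = \<zero>\<^bsub>left_ideal_module S (f i)\<^esub>"
      by (intro bexI[of _ "(- a) * f i"])
        (auto simp: left_ideal_module_def intro: image_eqI[of _ _ "- a"])
  qed (auto simp: left_ideal_module_def algebra_simps)
  have "a * (x * f i) \<in> (\<lambda>x. x * f i) ` S" if "a \<in> S" "x \<in> S" for a x
    using that by (intro image_eqI[of _ _ "a * x"]) (auto simp: mult.assoc)
  then show ?thesis
    unfolding left_module_def using ab by (auto simp: left_ideal_module_def algebra_simps)
qed

lemma left_ideal_irreducible:
  assumes i: "i < r"
  shows "irreducible_module S (left_ideal_module S (f i))"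
  unfolding irreducible_module_def
proof (intro conjI allI impI left_ideal_left_module[OF i])
  have "f i \<in> carrier (left_ideal_module S (f i))"
    by (auto simp: left_ideal_module_def intro: image_eqI[of _ _ 1])
  then show "carrier (left_ideal_module S (f i)) \<noteq> {\<zero>\<^bsub>left_ideal_module S (f i)\<^esub>}"
    using f_nonzero[OF i] by (auto simp: left_ideal_module_def)
next
  fix W assume W: "left_submodule S W (left_ideal_module S (f i))"
  note sub = left_submodule_subset[OF W] left_submodule_zero[OF W] left_submodule_smult[OF W]
  show "W = {\<zero>\<^bsub>left_ideal_module S (f i)\<^esub>} \<or> W = carrier (left_ideal_module S (f i))"
  proof (cases "W \<subseteq> {0}")
    case True
    then show ?thesis using sub(2) by (auto simp: left_ideal_module_def)
  next
    case False
    then obtain w where w: "w \<in> W" "w \<noteq> 0" by blast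
    then obtain x where x: "x \<in> S" "w = x * f i"
      using sub(1) by (auto simp: left_ideal_module_def)
    obtain y where "y \<in> S" "y * w = f i"
      using left_ideal_recovers_generator[OF i x(1)] x(2) w(2) by blast
    then have "f i \<in> W"
      using sub(3)[of y w] w(1) by (simp add: left_ideal_module_def)
    then have "carrier (left_ideal_module S (f i)) \<subseteq> W"
      using sub(3)[of _ "f i"] by (auto simp: left_ideal_module_def)
    then show ?thesis using sub(1) by blast
  qed
qed

lemma left_ideal_block:
  assumes i: "i < r"
  shows "fixes_pointwise (left_ideal_module S (f i)) (e i)"
  unfolding fixes_pointwise_def
proof
  fix v assume "v \<in> carrier (left_ideal_module S (f i))"
  then obtain x where x: "x \<in> S" "v = x * f i" by (auto simp: left_ideal_module_def)
  have "e i * v = x * (e i * f i)"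
    using e_commute[OF i x(1)] x(2) by (metis mult.assoc)
  then show "e i \<odot>\<^bsub>left_ideal_module S (f i)\<^esub> v = v"
    using x(2) e_f[OF i] by (simp add: left_ideal_module_def)
qed

lemma annihilates_left_ideal:
  assumes i: "i < r" and x: "x \<in> S" and ann: "annihilates (left_ideal_module S (f i)) x"
  shows "x * e i = 0"
proof -
  have "x * (p i a * f i) = 0" if "a < d i" for a
    using ann p_mem[OF i that] by (auto simp: annihilates_def left_ideal_module_def)
  then have "x * (p i a * f i * q i a) = 0" if "a < d i" for a
    using that by (metis mult.assoc mult_zero_left)
  then show ?thesis
    by (simp add: e_generated[OF i] sum_distrib_left)
qed

lemma annihilates_block:
  assumes M: "irreducible_module S M" and i: "i < r" and fixed: "fixes_pointwise M (e i)"
    and x: "x \<in> S" and ann: "annihilates M x"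
  shows "x * e i = 0"
proof -
  have iso: "isomorphic_modules S M (left_ideal_module S (f i))"
    by (rule isomorphic_if_same_block[OF M left_ideal_irreducible[OF i] i fixed left_ideal_block[OF i]])
  have "annihilates (left_ideal_module S (f i)) x"
    by (rule isomorphic_modules_annihilates[OF iso _ _ x ann])
      (use irreducible_module_left_module[OF M] left_ideal_left_module[OF i] left_moduleD(1) in blast)+
  then show ?thesis by (rule annihilates_left_ideal[OF i x])
qed

definition block :: "('a, 'a) module set \<Rightarrow> nat" where
  "block \<nu> = (SOME i. i < r \<and> fixes_pointwise (irr_rep \<nu>) (e i))"

lemma block:
  assumes "\<nu> \<in> Irr S"
  shows "block \<nu> < r" "fixes_pointwise (irr_rep \<nu>) (e (block \<nu>))"
proof -
  have "\<exists>i. i < r \<and> fixes_pointwise (irr_rep \<nu>) (e i)"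
    using irreducible_block[OF irr_rep_irreducible[OF assms]] by blast
  from someI_ex[OF this]
  show "block \<nu> < r" "fixes_pointwise (irr_rep \<nu>) (e (block \<nu>))"
    unfolding block_def by blast+
qed

lemma inj_block: "inj_on block (Irr S)"
proof (rule inj_onI)
  fix \<mu> \<nu> assume \<mu>\<nu>: "\<mu> \<in> Irr S" "\<nu> \<in> Irr S" "block \<mu> = block \<nu>"
  have "isomorphic_modules S (irr_rep \<mu>) (irr_rep \<nu>)"
    by (rule isomorphic_if_same_block[OF _ _ block(1)[OF \<mu>\<nu>(1)] block(2)[OF \<mu>\<nu>(1)]])
      (use block(2)[OF \<mu>\<nu>(2)] \<mu>\<nu> irr_rep_irreducible in auto)
  then show "\<mu> = \<nu>" using Irr_eq_iff \<mu>\<nu> by blast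
qed

lemma block_surj: "block ` Irr S = {..<r}"
proof
  show "block ` Irr S \<subseteq> {..<r}" using block(1) by blast
  show "{..<r} \<subseteq> block ` Irr S"
  proof
    fix i assume "i \<in> {..<r}"
    then have i: "i < r" by simp
    obtain \<nu> where \<nu>: "\<nu> \<in> Irr S" "isomorphic_modules S (left_ideal_module S (f i)) (irr_rep \<nu>)"
      using irr_rep_exhaustive[OF left_ideal_irreducible[OF i]] by blast
    have fixed: "fixes_pointwise (irr_rep \<nu>) (e i)"
      by (rule isomorphic_modules_fixes_pointwise[OF \<nu>(2) e_mem[OF i] left_ideal_block[OF i]])
    have irr: "irreducible_module S (irr_rep \<nu>)" by (rule irr_rep_irreducible[OF \<nu>(1)])
    have "block \<nu> = i"
      using other_blocks_annihilate[OF irreducible_module_left_module[OF irr] i block(1)[OF \<nu>(1)] _ fixed]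
        not_annihilates_if_fixes[OF irr block(2)[OF \<nu>(1)]] by blast
    then show "i \<in> block ` Irr S" using \<nu>(1) by blast
  qed
qed

text \<open>
  The left ideals of the \<open>f i\<close> are among the irreducible modules, and jointly they are faithful.
\<close>

lemma annihilates_all_irreducibles:
  assumes x: "x \<in> S" and "\<And>\<nu>. \<nu> \<in> Irr S \<Longrightarrow> annihilates (irr_rep \<nu>) x"
  shows "x = 0"
proof -
  have "x * e i = 0" if i: "i < r" for i
  proof -
    obtain \<nu> where \<nu>: "\<nu> \<in> Irr S" "i = block \<nu>" using block_surj i by blast
    show ?thesis
      using annihilates_block[OF irr_rep_irreducible[OF \<nu>(1)] i _ x] block(2)[OF \<nu>(1)] assms(2) \<nu>
      by simp
  qed
  then show ?thesis using mult_sum_e[of x] by simp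
qed

text \<open>
  The defining description of \<open>irr_idem S \<nu>\<close> fixes its action on every irreducible module, so
  faithfulness leaves only one candidate.
\<close>

lemma irr_idem_eq:
  assumes \<nu>: "\<nu> \<in> Irr S"
  shows "irr_idem S \<nu> = e (block \<nu>)"
proof -
  have ann: "annihilates (irr_rep \<nu>') (e (block \<nu>))" if \<nu>': "\<nu>' \<in> Irr S" "\<nu>' \<noteq> \<nu>" for \<nu>'
    using other_blocks_annihilate[OF irreducible_module_left_module[OF irr_rep_irreducible[OF \<nu>'(1)]]
        block(1)[OF \<nu>'(1)] block(1)[OF \<nu>] _ block(2)[OF \<nu>'(1)]]
      inj_onD[OF inj_block] \<nu> \<nu>' by blast
  show ?thesis
    unfolding irr_idem_def
  proof (rule the_equality)
    show "primitive_central_idempotent S (e (block \<nu>)) \<and>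
     (\<forall>v\<in>carrier (irr_rep \<nu>). e (block \<nu>) \<odot>\<^bsub>irr_rep \<nu>\<^esub> v = v) \<and>
     (\<forall>\<nu>'\<in>Irr S. \<nu>' \<noteq> \<nu> \<longrightarrow>
        (\<forall>v\<in>carrier (irr_rep \<nu>'). e (block \<nu>) \<odot>\<^bsub>irr_rep \<nu>'\<^esub> v = \<zero>\<^bsub>irr_rep \<nu>'\<^esub>))"
      using e_primitive[OF block(1)[OF \<nu>]] block(2)[OF \<nu>] ann
      unfolding fixes_pointwise_def annihilates_def by blast
  next
    fix x assume x: "primitive_central_idempotent S x \<and>
     (\<forall>v\<in>carrier (irr_rep \<nu>). x \<odot>\<^bsub>irr_rep \<nu>\<^esub> v = v) \<and>
     (\<forall>\<nu>'\<in>Irr S. \<nu>' \<noteq> \<nu> \<longrightarrow>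
        (\<forall>v\<in>carrier (irr_rep \<nu>'). x \<odot>\<^bsub>irr_rep \<nu>'\<^esub> v = \<zero>\<^bsub>irr_rep \<nu>'\<^esub>))"
    then have xS: "x \<in> S"
      unfolding primitive_central_idempotent_def center_def by blast
    have eS: "e (block \<nu>) \<in> S" by (rule e_mem[OF block(1)[OF \<nu>]])
    have "annihilates (irr_rep \<nu>') (x - e (block \<nu>))" if \<nu>': "\<nu>' \<in> Irr S" for \<nu>'
      unfolding annihilates_def
    proof
      fix v assume v: "v \<in> carrier (irr_rep \<nu>')"
      have "x \<odot>\<^bsub>irr_rep \<nu>'\<^esub> v = e (block \<nu>) \<odot>\<^bsub>irr_rep \<nu>'\<^esub> v"
        using x v \<nu>' ann[OF \<nu>'] block(2)[OF \<nu>]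
        by (cases "\<nu>' = \<nu>") (auto simp: fixes_pointwise_def annihilates_def)
      then show "(x - e (block \<nu>)) \<odot>\<^bsub>irr_rep \<nu>'\<^esub> v = \<zero>\<^bsub>irr_rep \<nu>'\<^esub>"
        using smult_eq_iff_diff[OF irreducible_module_left_module[OF irr_rep_irreducible[OF \<nu>']]
            v xS eS] by blast
    qed
    then show "x = e (block \<nu>)"
      using annihilates_all_irreducibles[of "x - e (block \<nu>)"] xS eS by simp
  qed
qed

end

section \<open>Matrix units of a split semisimple algebra\<close>

text \<open>
  An isomorphism onto a direct sum of matrix algebras, read entry by entry: \<open>c x i u v\<close> is the
  \<open>(u, v)\<close> entry of the \<open>i\<close>-th component of \<open>x\<close>. Working with entries in the field turns the
  identities between matrix units into sums with a single nonzero term.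
\<close>

locale matrix_coordinates = unital_subalgebra scale S
  for scale :: "'k::field \<Rightarrow> 'a::ring_1 \<Rightarrow> 'a" and S +
  fixes r :: nat and d :: "nat \<Rightarrow> nat" and c :: "'a \<Rightarrow> nat \<Rightarrow> nat \<Rightarrow> nat \<Rightarrow> 'k"
  assumes d_pos: "i < r \<Longrightarrow> 0 < d i"
    and coord_one: "i < r \<Longrightarrow> u < d i \<Longrightarrow> v < d i \<Longrightarrow> c 1 i u v = of_bool (u = v)"
    and coord_add: "x \<in> S \<Longrightarrow> y \<in> S \<Longrightarrow> i < r \<Longrightarrow> u < d i \<Longrightarrow> v < d i \<Longrightarrow>
      c (x + y) i u v = c x i u v + c y i u v"
    and coord_mult: "x \<in> S \<Longrightarrow> y \<in> S \<Longrightarrow> i < r \<Longrightarrow> u < d i \<Longrightarrow> v < d i \<Longrightarrow>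
      c (x * y) i u v = (\<Sum>w<d i. c x i u w * c y i w v)"
    and coord_scale: "x \<in> S \<Longrightarrow> i < r \<Longrightarrow> u < d i \<Longrightarrow> v < d i \<Longrightarrow>
      c (scale k x) i u v = k * c x i u v"
    and coord_inj: "x \<in> S \<Longrightarrow> y \<in> S \<Longrightarrow>
      (\<And>i u v. i < r \<Longrightarrow> u < d i \<Longrightarrow> v < d i \<Longrightarrow> c x i u v = c y i u v) \<Longrightarrow> x = y"
    and coord_surj: "\<exists>x\<in>S. \<forall>i<r. \<forall>u<d i. \<forall>v<d i. c x i u v = g i u v"
begin

lemma coord_zero: "i < r \<Longrightarrow> u < d i \<Longrightarrow> v < d i \<Longrightarrow> c 0 i u v = 0"
  using coord_scale[of 0 i u v 0] by simp

lemma coord_sum: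
  assumes "finite I" "\<And>j. j \<in> I \<Longrightarrow> g j \<in> S" "i < r" "u < d i" "v < d i"
  shows "c (\<Sum>j\<in>I. g j) i u v = (\<Sum>j\<in>I. c (g j) i u v)"
  using assms by (induction I rule: finite_induct) (simp_all add: coord_zero coord_add)

definition from_coords :: "(nat \<Rightarrow> nat \<Rightarrow> nat \<Rightarrow> 'k) \<Rightarrow> 'a" where
  "from_coords g = (SOME x. x \<in> S \<and> (\<forall>i<r. \<forall>u<d i. \<forall>v<d i. c x i u v = g i u v))"

lemma from_coords:
  shows "from_coords g \<in> S"
    and "i < r \<Longrightarrow> u < d i \<Longrightarrow> v < d i \<Longrightarrow> c (from_coords g) i u v = g i u v"
proof -
  have "\<exists>x. x \<in> S \<and> (\<forall>i<r. \<forall>u<d i. \<forall>v<d i. c x i u v = g i u v)"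
    using coord_surj by blast
  from someI_ex[OF this] show "from_coords g \<in> S"
    and "i < r \<Longrightarrow> u < d i \<Longrightarrow> v < d i \<Longrightarrow> c (from_coords g) i u v = g i u v"
    unfolding from_coords_def by blast+
qed

definition matrix_unit :: "nat \<Rightarrow> nat \<Rightarrow> nat \<Rightarrow> 'a" where
  "matrix_unit j a b = from_coords (\<lambda>i u v. of_bool (i = j \<and> u = a \<and> v = b))"

definition block_one :: "nat \<Rightarrow> 'a" where
  "block_one j = from_coords (\<lambda>i u v. of_bool (i = j \<and> u = v))"

lemma matrix_unit_mem [simp]: "matrix_unit j a b \<in> S"
  and block_one_mem [simp]: "block_one j \<in> S"
  by (simp_all add: matrix_unit_def block_one_def from_coords)

lemma coord_matrix_unit_mult:
  assumes "x \<in> S" "i < r" "u < d i" "v < d i" "b < d j"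
  shows "c (matrix_unit j a b * x) i u v = (if i = j \<and> u = a then c x i b v else 0)"
proof -
  have "c (matrix_unit j a b * x) i u v =
      (\<Sum>w<d i. of_bool (i = j \<and> u = a \<and> w = b) * c x i w v)"
    using assms by (simp add: coord_mult) (simp add: matrix_unit_def from_coords)
  also have "\<dots> = (\<Sum>w<d i. if w = b then (if i = j \<and> u = a then c x i w v else 0) else 0)"
    by (rule sum.cong) auto
  finally show ?thesis using assms by auto
qed

lemma coord_mult_matrix_unit:
  assumes "x \<in> S" "i < r" "u < d i" "v < d i" "a < d j"
  shows "c (x * matrix_unit j a b) i u v = (if i = j \<and> v = b then c x i u a else 0)"
proof -
  have "c (x * matrix_unit j a b) i u v =
      (\<Sum>w<d i. c x i u w * of_bool (i = j \<and> w = a \<and> v = b))"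
    using assms by (simp add: coord_mult) (simp add: matrix_unit_def from_coords)
  also have "\<dots> = (\<Sum>w<d i. if w = a then (if i = j \<and> v = b then c x i u w else 0) else 0)"
    by (rule sum.cong) auto
  finally show ?thesis using assms by auto
qed

lemma coord_block_one_mult:
  assumes "x \<in> S" "i < r" "u < d i" "v < d i"
  shows "c (block_one j * x) i u v = (if i = j then c x i u v else 0)"
proof -
  have "c (block_one j * x) i u v = (\<Sum>w<d i. of_bool (i = j \<and> u = w) * c x i w v)"
    using assms by (simp add: coord_mult) (simp add: block_one_def from_coords)
  also have "\<dots> = (\<Sum>w<d i. if w = u then (if i = j then c x i w v else 0) else 0)"
    by (rule sum.cong) auto
  finally show ?thesis using assms by auto
qed

lemma coord_mult_block_one:
  assumes "x \<in> S" "i < r" "u < d i" "v < d i"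
  shows "c (x * block_one j) i u v = (if i = j then c x i u v else 0)"
proof -
  have "c (x * block_one j) i u v = (\<Sum>w<d i. c x i u w * of_bool (i = j \<and> w = v))"
    using assms by (simp add: coord_mult) (simp add: block_one_def from_coords)
  also have "\<dots> = (\<Sum>w<d i. if w = v then (if i = j then c x i u w else 0) else 0)"
    by (rule sum.cong) auto
  finally show ?thesis using assms by auto
qed

lemma coord_matrix_unit:
  "i < r \<Longrightarrow> u < d i \<Longrightarrow> v < d i \<Longrightarrow>
    c (matrix_unit j a b) i u v = of_bool (i = j \<and> u = a \<and> v = b)"
  by (simp add: matrix_unit_def from_coords)

lemma coord_block_one:
  "i < r \<Longrightarrow> u < d i \<Longrightarrow> v < d i \<Longrightarrow> c (block_one j) i u v = of_bool (i = j \<and> u = v)"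
  by (simp add: block_one_def from_coords)

lemma block_idempotents:
  "block_idempotents scale S r block_one (\<lambda>i. matrix_unit i 0 0) d
     (\<lambda>i a. matrix_unit i a 0) (\<lambda>i a. matrix_unit i 0 a)"
proof
  fix i assume i: "i < r"
  note pos = d_pos[OF i]
  show "block_one i \<in> center S"
    unfolding center_def
    by (auto intro!: coord_inj simp: coord_block_one_mult coord_mult_block_one)
  show "matrix_unit i 0 0 * matrix_unit i 0 0 = matrix_unit i 0 0"
    using pos by (intro coord_inj) (auto simp: coord_matrix_unit_mult coord_matrix_unit)
  show "matrix_unit i 0 0 \<noteq> 0"
    using coord_matrix_unit[OF i pos pos, of i 0 0] coord_zero[OF i pos pos] by auto
  show "block_one i * matrix_unit i 0 0 = matrix_unit i 0 0"
    by (intro coord_inj) (auto simp: coord_block_one_mult coord_matrix_unit)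
  show "\<exists>k. matrix_unit i 0 0 * x * matrix_unit i 0 0 = scale k (matrix_unit i 0 0)"
    if x: "x \<in> S" for x
    by (intro exI[of _ "c x i 0 0"] coord_inj)
      (use pos x in \<open>auto simp: coord_mult_matrix_unit coord_matrix_unit_mult coord_scale
        coord_matrix_unit\<close>)
  show "block_one i = (\<Sum>a<d i. matrix_unit i a 0 * matrix_unit i 0 0 * matrix_unit i 0 a)"
  proof (rule coord_inj)
    fix j u v assume j: "j < r" and u: "u < d j" and v: "v < d j"
    have "c (\<Sum>a<d i. matrix_unit i a 0 * matrix_unit i 0 0 * matrix_unit i 0 a) j u v =
      (\<Sum>a<d i. c (matrix_unit i a 0 * matrix_unit i 0 0 * matrix_unit i 0 a) j u v)"
      by (rule coord_sum) (use j u v in auto)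
    also have "\<dots> = (\<Sum>a<d i. if a = u then of_bool (j = i \<and> u = v) else 0)"
      by (rule sum.cong[OF refl])
        (use pos j u v in \<open>auto simp: coord_mult_matrix_unit coord_matrix_unit_mult
          coord_matrix_unit\<close>)
    also have "\<dots> = of_bool (j = i \<and> u = v)" using u by auto
    finally show "c (block_one i) j u v =
      c (\<Sum>a<d i. matrix_unit i a 0 * matrix_unit i 0 0 * matrix_unit i 0 a) j u v"
      using j u v by (simp add: coord_block_one)
  qed auto
next
  fix i j assume "i < r" "j < r" "i \<noteq> j"
  then show "block_one i * block_one j = 0"
    by (intro coord_inj) (auto simp: coord_block_one_mult coord_block_one coord_zero)
next
  show "(\<Sum>i<r. block_one i) = 1"
  proof (rule coord_inj)
    fix j u v assume j: "j < r" and u: "u < d j" and v: "v < d j"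
    have "c (\<Sum>i<r. block_one i) j u v = (\<Sum>i<r. c (block_one i) j u v)"
      by (rule coord_sum) (use j u v in auto)
    also have "\<dots> = (\<Sum>i<r. if i = j then of_bool (u = v) else 0)"
      by (rule sum.cong[OF refl]) (use j u v in \<open>auto simp: coord_block_one\<close>)
    finally show "c (\<Sum>i<r. block_one i) j u v = c 1 j u v"
      using j u v by (simp add: coord_one)
  qed auto
qed auto

end

section \<open>Central idempotents of the irreducible classes\<close>

locale split_semisimple_subalgebra = unital_subalgebra scale S
  for scale :: "'k::field \<Rightarrow> 'a::ring_1 \<Rightarrow> 'a" and S +
  assumes split: "split_semisimple scale S"
begin

lemma obtain_blocks:
  obtains r e f d p q where "block_idempotents scale S r e f d p q"
proof -
  obtain r d and \<phi> :: "'a \<Rightarrow> nat \<Rightarrow> 'k mat" where \<phi>: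
    "(\<forall>i<r. 0 < d i) \<and>
     bij_betw \<phi> S (\<Pi>\<^sub>E i\<in>{..<r}. carrier_mat (d i) (d i)) \<and>
     (\<forall>i<r. \<phi> 1 i = 1\<^sub>m (d i)) \<and>
     (\<forall>x\<in>S. \<forall>y\<in>S. \<forall>i<r. \<phi> (x + y) i = \<phi> x i + \<phi> y i \<and> \<phi> (x * y) i = \<phi> x i * \<phi> y i) \<and>
     (\<forall>c. \<forall>x\<in>S. \<forall>i<r. \<phi> (scale c x) i = c \<cdot>\<^sub>m \<phi> x i)"
    using split unfolding split_semisimple_def by (elim exE)
  then have d: "\<And>i. i < r \<Longrightarrow> 0 < d i"
    and bij: "bij_betw \<phi> S (\<Pi>\<^sub>E i\<in>{..<r}. carrier_mat (d i) (d i))"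
    and one: "\<And>i. i < r \<Longrightarrow> \<phi> 1 i = 1\<^sub>m (d i)"
    and add: "\<And>x y i. x \<in> S \<Longrightarrow> y \<in> S \<Longrightarrow> i < r \<Longrightarrow> \<phi> (x + y) i = \<phi> x i + \<phi> y i"
    and mult: "\<And>x y i. x \<in> S \<Longrightarrow> y \<in> S \<Longrightarrow> i < r \<Longrightarrow> \<phi> (x * y) i = \<phi> x i * \<phi> y i"
    and scale: "\<And>k x i. x \<in> S \<Longrightarrow> i < r \<Longrightarrow> \<phi> (scale k x) i = k \<cdot>\<^sub>m \<phi> x i"
    by blast+
  have PiE: "\<phi> x \<in> (\<Pi>\<^sub>E i\<in>{..<r}. carrier_mat (d i) (d i))" if "x \<in> S" for x
    using bij_betwE[OF bij] that by blast
  then have carrier: "\<phi> x i \<in> carrier_mat (d i) (d i)" if "x \<in> S" "i < r" for x i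
    using that by auto
  have "matrix_coordinates scale S r d (\<lambda>x i u v. \<phi> x i $$ (u, v))"
  proof
    show "\<phi> 1 i $$ (u, v) = of_bool (u = v)" if "i < r" "u < d i" "v < d i" for i u v
      using that by (simp add: one)
    show "\<phi> (x + y) i $$ (u, v) = \<phi> x i $$ (u, v) + \<phi> y i $$ (u, v)"
      if "x \<in> S" "y \<in> S" "i < r" "u < d i" "v < d i" for x y i u v
      using that carrier[of y i] by (simp add: add)
    show "\<phi> (x * y) i $$ (u, v) = (\<Sum>w<d i. \<phi> x i $$ (u, w) * \<phi> y i $$ (w, v))"
      if "x \<in> S" "y \<in> S" "i < r" "u < d i" "v < d i" for x y i u v
      using that carrier[of x i] carrier[of y i]
      by (simp add: mult scalar_prod_def atLeast0LessThan)
    show "\<phi> (scale k x) i $$ (u, v) = k * \<phi> x i $$ (u, v)"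
      if "x \<in> S" "i < r" "u < d i" "v < d i" for k x i u v
      using that carrier[of x i] by (simp add: scale)
    show "x = y" if x: "x \<in> S" and y: "y \<in> S"
      and eq: "\<And>i u v. i < r \<Longrightarrow> u < d i \<Longrightarrow> v < d i \<Longrightarrow> \<phi> x i $$ (u, v) = \<phi> y i $$ (u, v)" for x y
    proof -
      have "\<phi> x = \<phi> y"
      proof (rule PiE_ext[OF PiE[OF x] PiE[OF y]])
        fix i assume "i \<in> {..<r}"
        then show "\<phi> x i = \<phi> y i"
          using eq carrier[OF x, of i] carrier[OF y, of i] by (intro eq_matI) auto
      qed
      then show ?thesis
        using bij x y by (simp add: bij_betw_def inj_on_def)
    qed
    show "\<exists>x\<in>S. \<forall>i<r. \<forall>u<d i. \<forall>v<d i. \<phi> x i $$ (u, v) = g i u v" for g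
    proof -
      let ?y = "\<lambda>i\<in>{..<r}. mat (d i) (d i) (\<lambda>(u, v). g i u v)"
      have "?y \<in> (\<Pi>\<^sub>E i\<in>{..<r}. carrier_mat (d i) (d i))" by simp
      then have "?y \<in> \<phi> ` S" using bij_betw_imp_surj_on[OF bij] by simp
      then obtain x where x: "x \<in> S" "?y = \<phi> x" by (rule imageE)
      have "\<phi> x i $$ (u, v) = g i u v" if "i < r" "u < d i" "v < d i" for i u v
        unfolding x(2)[symmetric] using that by simp
      then show ?thesis using x(1) by blast
    qed
  qed (rule d)
  then interpret matrix_coordinates scale S r d "\<lambda>x i u v. \<phi> x i $$ (u, v)" .
  show ?thesis using block_idempotents that by blast
qed

lemma irr_idem_center:
  assumes "\<nu> \<in> Irr S"
  shows "irr_idem S \<nu> \<in> center S"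
proof -
  obtain r e f d p q where "block_idempotents scale S r e f d p q" by (rule obtain_blocks)
  then interpret block_idempotents scale S r e f d p q .
  show ?thesis using assms by (simp add: irr_idem_eq e_center block)
qed

lemma irr_idem_mem: "\<nu> \<in> Irr S \<Longrightarrow> irr_idem S \<nu> \<in> S"
  using irr_idem_center by (simp add: center_def)

lemma irr_idem_commute: "\<nu> \<in> Irr S \<Longrightarrow> x \<in> S \<Longrightarrow> irr_idem S \<nu> * x = x * irr_idem S \<nu>"
  using irr_idem_center by (simp add: center_def)

lemma irr_idem_idempotent:
  assumes "\<nu> \<in> Irr S"
  shows "irr_idem S \<nu> * irr_idem S \<nu> = irr_idem S \<nu>"
proof -
  obtain r e f d p q where "block_idempotents scale S r e f d p q" by (rule obtain_blocks)
  then interpret block_idempotents scale S r e f d p q .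
  show ?thesis using assms by (simp add: irr_idem_eq e_idempotent block)
qed

lemma irr_idem_nonzero:
  assumes "\<nu> \<in> Irr S"
  shows "irr_idem S \<nu> \<noteq> 0"
proof -
  obtain r e f d p q where "block_idempotents scale S r e f d p q" by (rule obtain_blocks)
  then interpret block_idempotents scale S r e f d p q .
  show ?thesis using assms by (simp add: irr_idem_eq e_nonzero block)
qed

lemma irr_idem_orthogonal:
  assumes "\<mu> \<in> Irr S" "\<nu> \<in> Irr S" "\<mu> \<noteq> \<nu>"
  shows "irr_idem S \<mu> * irr_idem S \<nu> = 0"
proof -
  obtain r e f d p q where "block_idempotents scale S r e f d p q" by (rule obtain_blocks)
  then interpret block_idempotents scale S r e f d p q .
  have "block \<mu> \<noteq> block \<nu>" using inj_onD[OF inj_block] assms by blast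
  then show ?thesis using assms by (simp add: irr_idem_eq e_orthogonal block)
qed

lemma finite_Irr: "finite (Irr S)"
proof -
  obtain r e f d p q where "block_idempotents scale S r e f d p q" by (rule obtain_blocks)
  then interpret block_idempotents scale S r e f d p q .
  show ?thesis using finite_imageD[OF _ inj_block] block_surj by simp
qed

lemma sum_irr_idem: "(\<Sum>\<nu>\<in>Irr S. irr_idem S \<nu>) = 1"
proof -
  obtain r e f d p q where "block_idempotents scale S r e f d p q" by (rule obtain_blocks)
  then interpret block_idempotents scale S r e f d p q .
  have "(\<Sum>\<nu>\<in>Irr S. irr_idem S \<nu>) = (\<Sum>\<nu>\<in>Irr S. e (block \<nu>))"
    by (rule sum.cong) (simp_all add: irr_idem_eq)
  also have "\<dots> = (\<Sum>i\<in>block ` Irr S. e i)"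
    using sum.reindex[OF inj_block, of e] by simp
  finally show ?thesis by (simp add: block_surj e_sum)
qed

lemma irr_idem_fixes:
  assumes "\<nu> \<in> Irr S"
  shows "fixes_pointwise (irr_rep \<nu>) (irr_idem S \<nu>)"
proof -
  obtain r e f d p q where "block_idempotents scale S r e f d p q" by (rule obtain_blocks)
  then interpret block_idempotents scale S r e f d p q .
  show ?thesis using assms by (simp add: irr_idem_eq block)
qed

lemma irr_idem_annihilates:
  assumes "\<mu> \<in> Irr S" "\<nu> \<in> Irr S" "\<mu> \<noteq> \<nu>"
  shows "annihilates (irr_rep \<nu>) (irr_idem S \<mu>)"
proof -
  have M: "left_module S (irr_rep \<nu>)"
    using irr_rep_irreducible[OF assms(2)] by (rule irreducible_module_left_module)
  have "irr_idem S \<mu> \<odot>\<^bsub>irr_rep \<nu>\<^esub> v = \<zero>\<^bsub>irr_rep \<nu>\<^esub>" if v: "v \<in> carrier (irr_rep \<nu>)" for v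
    using left_moduleD(5)[OF M irr_idem_mem[OF assms(1)] irr_idem_mem[OF assms(2)] v]
      irr_idem_fixes[OF assms(2)] irr_idem_orthogonal[OF assms] zero_smult[OF M v] v
    by (simp add: fixes_pointwise_def)
  then show ?thesis by (simp add: annihilates_def)
qed

lemma center_scalar_irr_idem:
  assumes "z \<in> center S"
  shows "\<exists>a. \<forall>\<nu>\<in>Irr S. z * irr_idem S \<nu> = scale (a \<nu>) (irr_idem S \<nu>)"
proof -
  obtain r e f d p q where "block_idempotents scale S r e f d p q" by (rule obtain_blocks)
  then interpret block_idempotents scale S r e f d p q .
  have "\<forall>\<nu>\<in>Irr S. \<exists>a. z * irr_idem S \<nu> = scale a (irr_idem S \<nu>)"
    using center_scalar[OF _ assms] by (simp add: irr_idem_eq block)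
  then show ?thesis by (rule bchoice)
qed

lemma irr_idem_faithful:
  assumes "x \<in> S" "\<nu> \<in> Irr S" "annihilates (irr_rep \<nu>) x"
  shows "x * irr_idem S \<nu> = 0"
proof -
  obtain r e f d p q where "block_idempotents scale S r e f d p q" by (rule obtain_blocks)
  then interpret block_idempotents scale S r e f d p q .
  show ?thesis
    using annihilates_block[OF irr_rep_irreducible block(1) block(2)] assms
    by (simp add: irr_idem_eq)
qed

lemma isomorphic_irr_rep_if_not_annihilated:
  assumes M: "irreducible_module S (M :: ('a, 'a) module)" and \<mu>: "\<mu> \<in> Irr S"
    and "\<not> annihilates M (irr_idem S \<mu>)"
  shows "isomorphic_modules S M (irr_rep \<mu>)"
proof -
  obtain \<nu> where \<nu>: "\<nu> \<in> Irr S" "isomorphic_modules S M (irr_rep \<nu>)"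
    using irr_rep_exhaustive[OF M] by blast
  have "\<mu> = \<nu>"
  proof (rule ccontr)
    assume "\<mu> \<noteq> \<nu>"
    then have "annihilates (irr_rep \<nu>) (irr_idem S \<mu>)"
      by (rule irr_idem_annihilates[OF \<mu> \<nu>(1)])
    moreover have "isomorphic_modules S (irr_rep \<nu>) M"
      by (rule irreducible_isomorphic_sym[OF \<nu>(2) M])
    ultimately have "annihilates M (irr_idem S \<mu>)"
      using isomorphic_modules_annihilates[OF _ _ _ irr_idem_mem[OF \<mu>]]
        M irr_rep_irreducible[OF \<nu>(1)] irreducible_module_left_module left_moduleD(1) by metis
    then show False using assms(3) by blast
  qed
  then show ?thesis using \<nu>(2) by simp
qed

end

section \<open>The branching graph\<close>

lemma left_module_restrict: "left_module S' M \<Longrightarrow> S \<subseteq> S' \<Longrightarrow> left_module S M"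
  unfolding left_module_def by blast

context multiplicity_free_family begin

sublocale level: split_semisimple_subalgebra scale "A n" for n
  by unfold_locales (rule subalgebra split_semisimple)+

lemma Suc_mem: "x \<in> A n \<Longrightarrow> x \<in> A (Suc n)"
  using increasing by blast

text \<open>
  If the product is nonzero, the idempotent \<open>\<epsilon>\<close> of \<open>\<mu>\<close> acts nontrivially on the module \<open>V\<close> of \<open>\<nu>\<close>.
  In the multiplicity-free decomposition of \<open>V\<close> it then fixes exactly one summand, which is
  isomorphic to the module of \<open>\<mu>\<close>, and annihilates the others. So the image of \<open>\<epsilon>\<close> in \<open>V\<close> is a copy
  of the module of \<open>\<mu>\<close>, complemented by the kernel of \<open>\<epsilon>\<close>.
\<close>

lemma branching_edge_if_product_nonzero:
  assumes \<mu>: "\<mu> \<in> Irr (A n)" and \<nu>: "\<nu> \<in> Irr (A (Suc n))"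
    and nonzero: "irr_idem (A n) \<mu> * irr_idem (A (Suc n)) \<nu> \<noteq> 0"
  shows "branching_edge A n \<mu> \<nu>"
proof -
  define V where "V = irr_rep \<nu>"
  define \<epsilon> where "\<epsilon> = irr_idem (A n) \<mu>"
  have irrV: "irreducible_module (A (Suc n)) V"
    unfolding V_def by (rule level.irr_rep_irreducible[OF \<nu>])
  have V: "left_module (A n) V"
    by (rule left_module_restrict[OF irreducible_module_left_module[OF irrV] increasing])
  interpret V: abelian_group V by (rule left_moduleD(1)[OF V])
  have \<epsilon>c: "\<epsilon> \<in> center (A n)" and \<epsilon>A: "\<epsilon> \<in> A n" and \<epsilon>\<epsilon>: "\<epsilon> * \<epsilon> = \<epsilon>"
    unfolding \<epsilon>_def
    by (rule level.irr_idem_center[OF \<mu>] level.irr_idem_mem[OF \<mu>] level.irr_idem_idempotent[OF \<mu>])+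
  obtain r and M :: "nat \<Rightarrow> ('a, 'a) module" where
    M: "\<And>i. i < r \<Longrightarrow> irreducible_module (A n) (M i)"
    and distinct: "\<And>i j. i < r \<Longrightarrow> j < r \<Longrightarrow> i \<noteq> j \<Longrightarrow> \<not> isomorphic_modules (A n) (M i) (M j)"
    and iso: "isomorphic_modules (A n) V (direct_sum_module r M)"
    using multiplicity_free[OF irrV] by blast
  have Mmod: "left_module (A n) (M i)" if "i < r" for i
    by (rule irreducible_module_left_module[OF M[OF that]])
  obtain g where g: "bij_betw g (carrier V) (\<Pi>\<^sub>E i\<in>{..<r}. carrier (M i))"
    and g_add': "\<And>v w. v \<in> carrier V \<Longrightarrow> w \<in> carrier V \<Longrightarrow>
      g (v \<oplus>\<^bsub>V\<^esub> w) = g v \<oplus>\<^bsub>direct_sum_module r M\<^esub> g w"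
    and g_smult': "\<And>a v. a \<in> A n \<Longrightarrow> v \<in> carrier V \<Longrightarrow>
      g (a \<odot>\<^bsub>V\<^esub> v) = a \<odot>\<^bsub>direct_sum_module r M\<^esub> g v"
    using iso unfolding isomorphic_modules_def by (auto simp: direct_sum_module_def)
  have g_PiE: "g v \<in> (\<Pi>\<^sub>E i\<in>{..<r}. carrier (M i))" if "v \<in> carrier V" for v
    using bij_betwE[OF g] that by blast
  have g_mem: "g v i \<in> carrier (M i)" if "v \<in> carrier V" "i < r" for v i
    using g_PiE[OF that(1)] that(2) by auto
  have g_add: "g (v \<oplus>\<^bsub>V\<^esub> w) i = g v i \<oplus>\<^bsub>M i\<^esub> g w i"
    if "v \<in> carrier V" "w \<in> carrier V" "i < r" for v w i
    using g_add'[OF that(1,2)] that(3) by (simp add: direct_sum_module_def)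
  have g_smult: "g (a \<odot>\<^bsub>V\<^esub> v) i = a \<odot>\<^bsub>M i\<^esub> g v i"
    if "a \<in> A n" "v \<in> carrier V" "i < r" for a v i
    using g_smult'[OF that(1,2)] that(3) by (simp add: direct_sum_module_def)
  have g_inj: "v = w" if vw: "v \<in> carrier V" "w \<in> carrier V"
    and eq: "\<And>i. i < r \<Longrightarrow> g v i = g w i" for v w
  proof -
    have "g v = g w"
      by (rule PiE_ext[OF g_PiE[OF vw(1)] g_PiE[OF vw(2)]]) (simp add: eq)
    then show ?thesis
      using inj_onD[OF bij_betw_imp_inj_on[OF g]] vw by blast
  qed
  have g_zero: "g \<zero>\<^bsub>V\<^esub> i = \<zero>\<^bsub>M i\<^esub>" if "i < r" for i
    using g_smult[OF level.closed(2) V.zero_closed that]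
      level.zero_smult[OF V V.zero_closed] level.zero_smult[OF Mmod[OF that] g_mem[OF V.zero_closed that]]
    by simp

  have "\<not> annihilates V \<epsilon>"
    using level.irr_idem_faithful[OF Suc_mem[OF \<epsilon>A] \<nu>] nonzero by (auto simp: V_def \<epsilon>_def)
  then obtain v0 where v0: "v0 \<in> carrier V" "\<epsilon> \<odot>\<^bsub>V\<^esub> v0 \<noteq> \<zero>\<^bsub>V\<^esub>"
    by (auto simp: annihilates_def)
  have "\<exists>i<r. \<not> annihilates (M i) \<epsilon>"
  proof (rule ccontr)
    assume *: "\<not> ?thesis"
    have "\<epsilon> \<odot>\<^bsub>V\<^esub> v0 = \<zero>\<^bsub>V\<^esub>"
    proof (rule g_inj)
      fix i assume i: "i < r"
      then show "g (\<epsilon> \<odot>\<^bsub>V\<^esub> v0) i = g \<zero>\<^bsub>V\<^esub> i"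
        using * g_smult[OF \<epsilon>A v0(1) i] g_mem[OF v0(1) i] g_zero[OF i]
        by (simp add: annihilates_def)
    qed (use left_moduleD(2)[OF V \<epsilon>A v0(1)] in auto)
    then show False using v0(2) by blast
  qed
  then obtain i where i: "i < r" "\<not> annihilates (M i) \<epsilon>" by blast
  have Mi: "isomorphic_modules (A n) (M i) (irr_rep \<mu>)"
    by (rule level.isomorphic_irr_rep_if_not_annihilated[OF M[OF i(1)] \<mu> i(2)[unfolded \<epsilon>_def]])
  have \<mu>Mi: "isomorphic_modules (A n) (irr_rep \<mu>) (M i)"
    by (rule irreducible_isomorphic_sym[OF Mi M[OF i(1)]])
  have fixed: "fixes_pointwise (M i) \<epsilon>"
    by (rule isomorphic_modules_fixes_pointwise[OF \<mu>Mi \<epsilon>A])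
      (use level.irr_idem_fixes[OF \<mu>] in \<open>simp add: \<epsilon>_def\<close>)
  \<comment> \<open>Here multiplicity-freeness enters: no other summand belongs to the class of \<open>\<mu>\<close>.\<close>
  have killed: "annihilates (M j) \<epsilon>" if j: "j < r" "j \<noteq> i" for j
  proof (rule ccontr)
    assume "\<not> annihilates (M j) \<epsilon>"
    then have "isomorphic_modules (A n) (M j) (irr_rep \<mu>)"
      using level.isomorphic_irr_rep_if_not_annihilated[OF M[OF j(1)] \<mu>] by (simp add: \<epsilon>_def)
    then have "isomorphic_modules (A n) (M j) (M i)"
      using \<mu>Mi by (rule isomorphic_modules_trans)
    then show False using distinct[OF j(1) i(1) j(2)] by blast
  qed

  define W where "W = {v \<in> carrier V. \<epsilon> \<odot>\<^bsub>V\<^esub> v = v}"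
  define W' where "W' = {v \<in> carrier V. \<epsilon> \<odot>\<^bsub>V\<^esub> v = \<zero>\<^bsub>V\<^esub>}"
  have subW: "left_submodule (A n) W V" and subW': "left_submodule (A n) W' V"
    unfolding W_def W'_def
    by (rule level.central_fixed_submodule[OF V \<epsilon>c] level.central_kernel_submodule[OF V \<epsilon>c])+
  have W_other: "g v j = \<zero>\<^bsub>M j\<^esub>" if "v \<in> W" "j < r" "j \<noteq> i" for v j
    using g_smult[OF \<epsilon>A, of v j] killed[OF that(2,3)] g_mem[of v j] that
    by (auto simp: W_def annihilates_def)
  have "isomorphic_modules (A n) (V\<lparr>carrier := W\<rparr>) (M i)"
    unfolding isomorphic_modules_def
  proof (intro exI[of _ "\<lambda>v. g v i"] conjI ballI)
    show "bij_betw (\<lambda>v. g v i) (carrier (V\<lparr>carrier := W\<rparr>)) (carrier (M i))"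
      unfolding bij_betw_def
    proof
      show "inj_on (\<lambda>v. g v i) (carrier (V\<lparr>carrier := W\<rparr>))"
      proof (rule inj_onI)
        fix v w assume "v \<in> carrier (V\<lparr>carrier := W\<rparr>)" "w \<in> carrier (V\<lparr>carrier := W\<rparr>)"
          and eq: "g v i = g w i"
        then have vw: "v \<in> W" "w \<in> W" by simp_all
        show "v = w"
        proof (rule g_inj)
          fix j assume "j < r"
          then show "g v j = g w j"
            using W_other[OF vw(1)] W_other[OF vw(2)] eq by (cases "j = i") simp_all
        qed (use vw in \<open>simp_all add: W_def\<close>)
      qed
      show "(\<lambda>v. g v i) ` carrier (V\<lparr>carrier := W\<rparr>) = carrier (M i)"
      proof
        show "(\<lambda>v. g v i) ` carrier (V\<lparr>carrier := W\<rparr>) \<subseteq> carrier (M i)"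
          using g_mem i(1) by (auto simp: W_def)
        show "carrier (M i) \<subseteq> (\<lambda>v. g v i) ` carrier (V\<lparr>carrier := W\<rparr>)"
        proof
          fix m assume m: "m \<in> carrier (M i)"
          let ?y = "\<lambda>j\<in>{..<r}. if j = i then m else \<zero>\<^bsub>M j\<^esub>"
          have "\<zero>\<^bsub>M j\<^esub> \<in> carrier (M j)" if "j < r" for j
            using left_moduleD(1)[OF Mmod[OF that]] by (simp add: abelian_group_def abelian_monoid.zero_closed)
          then have "?y \<in> (\<Pi>\<^sub>E j\<in>{..<r}. carrier (M j))"
            using m by auto
          then have "?y \<in> g ` carrier V"
            using bij_betw_imp_surj_on[OF g] by simp
          then obtain v where v: "?y = g v" "v \<in> carrier V" by (rule imageE)
          have gv: "g v j = (if j = i then m else \<zero>\<^bsub>M j\<^esub>)" if "j < r" for j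
            using that by (simp flip: v(1))
          have "\<epsilon> \<odot>\<^bsub>V\<^esub> v = v"
          proof (rule g_inj)
            fix j assume j: "j < r"
            show "g (\<epsilon> \<odot>\<^bsub>V\<^esub> v) j = g v j"
              using g_smult[OF \<epsilon>A v(2) j] gv[OF j] fixed m level.smult_zero[OF Mmod[OF j] \<epsilon>A]
              by (auto simp: fixes_pointwise_def)
          qed (use v(2) left_moduleD(2)[OF V \<epsilon>A v(2)] in auto)
          then have "v \<in> W" using v(2) by (simp add: W_def)
          then show "m \<in> (\<lambda>v. g v i) ` carrier (V\<lparr>carrier := W\<rparr>)"
            using gv[OF i(1)] by (intro image_eqI[of _ _ v]) simp_all
        qed
      qed
    qed
  qed (use g_add g_smult i(1) in \<open>auto simp: W_def\<close>)
  then have "isomorphic_modules (A n) (M i) (V\<lparr>carrier := W\<rparr>)"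
    by (rule isomorphic_modules_sym)
      (use left_submodule_add[OF subW] left_submodule_smult[OF subW] in simp_all)
  with \<mu>Mi have iso_W: "isomorphic_modules (A n) (irr_rep \<mu>) (V\<lparr>carrier := W\<rparr>)"
    by (rule isomorphic_modules_trans)

  have "W \<inter> W' = {\<zero>\<^bsub>V\<^esub>}"
    using left_submodule_zero[OF subW] left_submodule_zero[OF subW'] by (auto simp: W_def W'_def)
  moreover have "set_add V W W' = carrier V"
  proof
    show "set_add V W W' \<subseteq> carrier V"
      by (auto simp: set_add_defs W_def W'_def)
    show "carrier V \<subseteq> set_add V W W'"
    proof
      fix v assume v: "v \<in> carrier V"
      have mem: "\<epsilon> \<odot>\<^bsub>V\<^esub> v \<in> carrier V" "(1 - \<epsilon>) \<odot>\<^bsub>V\<^esub> v \<in> carrier V"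
        using left_moduleD(2)[OF V _ v] \<epsilon>A by simp_all
      have "\<epsilon> \<odot>\<^bsub>V\<^esub> v \<in> W"
        using mem(1) left_moduleD(5)[OF V \<epsilon>A \<epsilon>A v] \<epsilon>\<epsilon> by (simp add: W_def)
      moreover have "\<epsilon> * (1 - \<epsilon>) = 0" using \<epsilon>\<epsilon> by (simp add: right_diff_distrib)
      then have "(1 - \<epsilon>) \<odot>\<^bsub>V\<^esub> v \<in> W'"
        using mem(2) left_moduleD(5)[OF V \<epsilon>A _ v, of "1 - \<epsilon>"] \<epsilon>A level.zero_smult[OF V v]
        by (simp add: W'_def)
      moreover have "v = \<epsilon> \<odot>\<^bsub>V\<^esub> v \<oplus>\<^bsub>V\<^esub> (1 - \<epsilon>) \<odot>\<^bsub>V\<^esub> v"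
        using left_moduleD(4)[OF V \<epsilon>A _ v, of "1 - \<epsilon>"] \<epsilon>A left_moduleD(6)[OF V v] by simp
      ultimately show "v \<in> set_add V W W'" by (auto simp: set_add_defs)
    qed
  qed
  ultimately have "isomorphic_to_direct_summand (A n) (irr_rep \<mu>) V"
    unfolding isomorphic_to_direct_summand_def using subW subW' iso_W by blast
  then show ?thesis
    unfolding branching_edge_def V_def using \<mu> \<nu> by blast
qed

lemma branching_edge_embedding:
  assumes "branching_edge A n \<mu> \<nu>"
  obtains h where
    "\<And>v. v \<in> carrier (irr_rep \<mu>) \<Longrightarrow> h v \<in> carrier (irr_rep \<nu>)"
    "\<And>v. v \<in> carrier (irr_rep \<mu>) \<Longrightarrow> v \<noteq> \<zero>\<^bsub>irr_rep \<mu>\<^esub> \<Longrightarrow> h v \<noteq> \<zero>\<^bsub>irr_rep \<nu>\<^esub>"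
    "\<And>a v. a \<in> A n \<Longrightarrow> v \<in> carrier (irr_rep \<mu>) \<Longrightarrow> h (a \<odot>\<^bsub>irr_rep \<mu>\<^esub> v) = a \<odot>\<^bsub>irr_rep \<nu>\<^esub> h v"
proof -
  have \<mu>: "\<mu> \<in> Irr (A n)" and \<nu>: "\<nu> \<in> Irr (A (Suc n))"
    using assms unfolding branching_edge_def by blast+
  have U: "left_module (A n) (irr_rep \<mu>)"
    by (rule irreducible_module_left_module[OF level.irr_rep_irreducible[OF \<mu>]])
  have V: "left_module (A n) (irr_rep \<nu>)"
    by (rule left_module_restrict[OF irreducible_module_left_module increasing])
      (rule level.irr_rep_irreducible[OF \<nu>])
  interpret U: abelian_group "irr_rep \<mu>" by (rule left_moduleD(1)[OF U])
  obtain W where W: "left_submodule (A n) W (irr_rep \<nu>)"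
    and "isomorphic_modules (A n) (irr_rep \<mu>) ((irr_rep \<nu>)\<lparr>carrier := W\<rparr>)"
    using assms unfolding branching_edge_def isomorphic_to_direct_summand_def by blast
  then obtain h where h: "bij_betw h (carrier (irr_rep \<mu>)) W"
    and h_smult: "\<And>a v. a \<in> A n \<Longrightarrow> v \<in> carrier (irr_rep \<mu>) \<Longrightarrow>
      h (a \<odot>\<^bsub>irr_rep \<mu>\<^esub> v) = a \<odot>\<^bsub>irr_rep \<nu>\<^esub> h v"
    unfolding isomorphic_modules_def by auto
  have h_mem: "h v \<in> carrier (irr_rep \<nu>)" if "v \<in> carrier (irr_rep \<mu>)" for v
    using bij_betwE[OF h] left_submodule_subset[OF W] that by blast
  have "h \<zero>\<^bsub>irr_rep \<mu>\<^esub> = \<zero>\<^bsub>irr_rep \<nu>\<^esub>"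
    using h_smult[OF level.closed(2) U.zero_closed] level.zero_smult[OF U U.zero_closed]
      level.zero_smult[OF V h_mem[OF U.zero_closed]] by simp
  then have "h v \<noteq> \<zero>\<^bsub>irr_rep \<nu>\<^esub>" if "v \<in> carrier (irr_rep \<mu>)" "v \<noteq> \<zero>\<^bsub>irr_rep \<mu>\<^esub>" for v
    using inj_onD[OF bij_betw_imp_inj_on[OF h], of v "\<zero>\<^bsub>irr_rep \<mu>\<^esub>"] that by auto
  then show ?thesis using that h_mem h_smult by blast
qed

text \<open>
  A path records a vertex at level 0, but \<open>path_idem\<close> starts at level 1. Since a field has no zero
  divisors, orthogonality leaves only one vertex at level 0, and its idempotent is \<open>1\<close>.
\<close>

lemma Irr_zero:
  obtains \<nu> where "Irr (A 0) = {\<nu>}" "irr_idem (A 0) \<nu> = 1"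
proof -
  obtain \<phi> :: "'a \<Rightarrow> 'k" where \<phi>: "bij_betw \<phi> (A 0) UNIV"
    and mult: "\<And>x y. x \<in> A 0 \<Longrightarrow> y \<in> A 0 \<Longrightarrow> \<phi> (x * y) = \<phi> x * \<phi> y"
    and add: "\<And>x y. x \<in> A 0 \<Longrightarrow> y \<in> A 0 \<Longrightarrow> \<phi> (x + y) = \<phi> x + \<phi> y"
    using zeroth unfolding isomorphic_to_field_def by blast
  have "\<phi> 0 = 0"
    using add[OF level.closed(2) level.closed(2)] by (metis add.right_neutral add_left_cancel)
  then have \<phi>0: "\<phi> x = 0 \<longleftrightarrow> x = 0" if "x \<in> A 0" for x
    using inj_onD[OF bij_betw_imp_inj_on[OF \<phi>], of x 0] that by auto
  have unique: "\<mu> = \<nu>" if "\<mu> \<in> Irr (A 0)" "\<nu> \<in> Irr (A 0)" for \<mu> \<nu>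
  proof (rule ccontr)
    assume "\<mu> \<noteq> \<nu>"
    then have "irr_idem (A 0) \<mu> * irr_idem (A 0) \<nu> = 0"
      by (rule level.irr_idem_orthogonal[OF that])
    then have "\<phi> (irr_idem (A 0) \<mu>) * \<phi> (irr_idem (A 0) \<nu>) = 0"
      using mult[OF level.irr_idem_mem[OF that(1)] level.irr_idem_mem[OF that(2)]] \<open>\<phi> 0 = 0\<close>
      by simp
    then show False
      using \<phi>0 level.irr_idem_mem level.irr_idem_nonzero that by auto
  qed
  have "Irr (A 0) \<noteq> {}" using level.sum_irr_idem[of 0] by auto
  then obtain \<nu> where "\<nu> \<in> Irr (A 0)" by blast
  then have "Irr (A 0) = {\<nu>}" using unique by blast
  moreover from this have "irr_idem (A 0) \<nu> = 1" using level.sum_irr_idem[of 0] by simp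
  ultimately show ?thesis by (rule that)
qed

section \<open>Path idempotents\<close>

lemma Tab_zero: "Tab A 0 = (\<lambda>\<nu>. [\<nu>]) ` Irr (A 0)"
  by (auto simp: Tab_def length_Suc_conv)

lemma Tab_length: "T \<in> Tab A n \<Longrightarrow> length T = Suc n"
  by (simp add: Tab_def)

lemma Tab_nonempty: "T \<in> Tab A n \<Longrightarrow> T \<noteq> []"
  using Tab_length by fastforce

lemma snoc_mem_Tab_iff:
  "T @ [\<nu>] \<in> Tab A (Suc n) \<longleftrightarrow> T \<in> Tab A n \<and> branching_edge A n (last T) \<nu>"
proof (cases "length T = Suc n")
  case True
  then have "last T = T ! n" by (metis diff_Suc_1 last_conv_nth list.size(3) nat.distinct(1))
  moreover have "(T @ [\<nu>]) ! k = T ! k" if "k \<le> n" for k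
    using True that by (simp add: nth_append)
  moreover have "(T @ [\<nu>]) ! Suc n = \<nu>"
    using True by (simp add: nth_append)
  ultimately show ?thesis
    using True by (auto simp: Tab_def All_less_Suc)
qed (auto simp: Tab_def)

lemma Tab_Suc_cases:
  assumes "T \<in> Tab A (Suc n)"
  obtains T0 \<nu> where "T = T0 @ [\<nu>]" "T0 \<in> Tab A n" "branching_edge A n (last T0) \<nu>"
  using assms snoc_mem_Tab_iff[of "butlast T" "last T" n] append_butlast_last_id[OF Tab_nonempty[OF assms]]
  by metis

lemma last_Tab:
  assumes "T \<in> Tab A n"
  shows "last T \<in> Irr (A n)"
proof (cases n)
  case 0
  then show ?thesis using assms by (auto simp: Tab_zero)
next
  case (Suc m)
  with assms have "T \<in> Tab A (Suc m)" by simp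
  then show ?thesis
    using Suc by (auto elim!: Tab_Suc_cases simp: branching_edge_def)
qed

lemma path_idem_snoc:
  assumes "T \<in> Tab A n"
  shows "path_idem A (T @ [\<nu>]) = path_idem A T * irr_idem (A (Suc n)) \<nu>"
proof -
  have len: "length T = Suc n" by (rule Tab_length[OF assms])
  let ?\<epsilon> = "\<lambda>T k. irr_idem (A k) (T ! k)"
  have upt: "[1..<length (T @ [\<nu>])] = [1..<Suc n] @ [Suc n]"
    using len by simp
  have "path_idem A (T @ [\<nu>]) = prod_list (map (?\<epsilon> (T @ [\<nu>])) [1..<Suc n]) * ?\<epsilon> (T @ [\<nu>]) (Suc n)"
    unfolding path_idem_def upt by (simp del: upt_Suc)
  also have "map (?\<epsilon> (T @ [\<nu>])) [1..<Suc n] = map (?\<epsilon> T) [1..<Suc n]"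
    using len by (intro map_cong) (auto simp: nth_append)
  finally show ?thesis
    unfolding path_idem_def using len by (simp add: nth_append del: upt_Suc)
qed

lemma path_idem_zero: "T \<in> Tab A 0 \<Longrightarrow> path_idem A T = 1"
  by (auto simp: Tab_zero path_idem_def)

lemma path_idem_mem: "T \<in> Tab A n \<Longrightarrow> path_idem A T \<in> A n"
proof (induction n arbitrary: T)
  case 0
  then show ?case by (simp add: path_idem_zero)
next
  case (Suc n)
  then obtain T0 \<nu> where T: "T = T0 @ [\<nu>]" "T0 \<in> Tab A n" "branching_edge A n (last T0) \<nu>"
    by (auto elim: Tab_Suc_cases)
  then show ?case
    using Suc_mem[OF Suc.IH[OF T(2)]] level.irr_idem_mem[of \<nu> "Suc n"]
    by (simp add: path_idem_snoc branching_edge_def)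
qed

lemma path_idem_mult_last:
  assumes "T \<in> Tab A n"
  shows "path_idem A T * irr_idem (A n) (last T) = path_idem A T"
proof (cases n)
  case 0
  obtain \<nu> where "Irr (A 0) = {\<nu>}" "irr_idem (A 0) \<nu> = 1" by (rule Irr_zero)
  then show ?thesis using assms 0 last_Tab[OF assms] by simp
next
  case (Suc m)
  with assms have "T \<in> Tab A (Suc m)" by simp
  then obtain T0 \<nu> where T: "T = T0 @ [\<nu>]" "T0 \<in> Tab A m" "branching_edge A m (last T0) \<nu>"
    by (rule Tab_Suc_cases)
  then have "irr_idem (A n) \<nu> * irr_idem (A n) \<nu> = irr_idem (A n) \<nu>"
    using level.irr_idem_idempotent Suc by (simp add: branching_edge_def)
  then show ?thesis using T Suc by (simp add: path_idem_snoc mult.assoc)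
qed

lemma finite_Tab: "finite (Tab A n)"
proof (induction n)
  case 0
  then show ?case by (simp add: Tab_zero level.finite_Irr)
next
  case (Suc n)
  have "Tab A (Suc n) \<subseteq> (\<lambda>(T, \<nu>). T @ [\<nu>]) ` (Tab A n \<times> Irr (A (Suc n)))"
    by (force elim!: Tab_Suc_cases simp: branching_edge_def)
  then show ?case
    using Suc level.finite_Irr by (meson finite_SigmaI finite_imageI finite_subset)
qed

lemma path_idem_orthogonal:
  "S \<in> Tab A n \<Longrightarrow> T \<in> Tab A n \<Longrightarrow> S \<noteq> T \<Longrightarrow> path_idem A S * path_idem A T = 0"
proof (induction n arbitrary: S T)
  case 0
  obtain \<nu> where "Irr (A 0) = {\<nu>}" by (rule Irr_zero)
  then show ?case using 0 by (simp add: Tab_zero)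
next
  case (Suc n)
  obtain S0 \<mu> where S: "S = S0 @ [\<mu>]" "S0 \<in> Tab A n" "\<mu> \<in> Irr (A (Suc n))"
    using Suc.prems(1) by (auto elim: Tab_Suc_cases simp: branching_edge_def)
  obtain T0 \<nu> where T: "T = T0 @ [\<nu>]" "T0 \<in> Tab A n" "\<nu> \<in> Irr (A (Suc n))"
    using Suc.prems(2) by (auto elim: Tab_Suc_cases simp: branching_edge_def)
  have "path_idem A S * path_idem A T = path_idem A S0 *
      (irr_idem (A (Suc n)) \<mu> * path_idem A T0) * irr_idem (A (Suc n)) \<nu>"
    using S T by (simp add: path_idem_snoc mult.assoc)
  also have "\<dots> = path_idem A S0 * path_idem A T0 *
      (irr_idem (A (Suc n)) \<mu> * irr_idem (A (Suc n)) \<nu>)"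
    using level.irr_idem_commute[OF S(3) Suc_mem[OF path_idem_mem[OF T(2)]]]
    by (simp add: mult.assoc)
  also have "\<dots> = 0"
  proof (cases "S0 = T0")
    case True
    then have "\<mu> \<noteq> \<nu>" using S T Suc.prems(3) by blast
    then show ?thesis using level.irr_idem_orthogonal[OF S(3) T(3)] by simp
  next
    case False
    then show ?thesis using Suc.IH[OF S(2) T(2)] by simp
  qed
  finally show ?case .
qed

text \<open>
  Every edge of the path embeds the module of its source into the module of its target. Pushing
  a vector along these embeddings keeps it nonzero and fixed by the idempotents passed so far.
\<close>

lemma path_idem_fixes_vector:
  assumes "T \<in> Tab A n"
  shows "\<exists>v\<in>carrier (irr_rep (last T)). v \<noteq> \<zero>\<^bsub>irr_rep (last T)\<^esub> \<and>
    path_idem A T \<odot>\<^bsub>irr_rep (last T)\<^esub> v = v"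
  using assms
proof (induction n arbitrary: T)
  case 0
  have irr: "irreducible_module (A 0) (irr_rep (last T))"
    by (rule level.irr_rep_irreducible[OF last_Tab[OF 0]])
  obtain v where "v \<in> carrier (irr_rep (last T))" "v \<noteq> \<zero>\<^bsub>irr_rep (last T)\<^esub>"
    by (rule irreducible_module_nonzero[OF irr])
  then show ?case
    using left_moduleD(6)[OF irreducible_module_left_module[OF irr]] path_idem_zero[OF 0] by auto
next
  case (Suc n)
  obtain T0 \<nu> where T: "T = T0 @ [\<nu>]" "T0 \<in> Tab A n" and edge: "branching_edge A n (last T0) \<nu>"
    using Suc.prems by (rule Tab_Suc_cases)
  have \<nu>: "\<nu> \<in> Irr (A (Suc n))" using edge by (simp add: branching_edge_def)
  have V: "left_module (A (Suc n)) (irr_rep \<nu>)"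
    by (rule irreducible_module_left_module[OF level.irr_rep_irreducible[OF \<nu>]])
  obtain v where v: "v \<in> carrier (irr_rep (last T0))" "v \<noteq> \<zero>\<^bsub>irr_rep (last T0)\<^esub>"
    "path_idem A T0 \<odot>\<^bsub>irr_rep (last T0)\<^esub> v = v"
    using Suc.IH[OF T(2)] by blast
  obtain h where h: "h v \<in> carrier (irr_rep \<nu>)" "h v \<noteq> \<zero>\<^bsub>irr_rep \<nu>\<^esub>"
    "h (path_idem A T0 \<odot>\<^bsub>irr_rep (last T0)\<^esub> v) = path_idem A T0 \<odot>\<^bsub>irr_rep \<nu>\<^esub> h v"
    using branching_edge_embedding[OF edge] v(1,2) path_idem_mem[OF T(2)] by metis
  have "path_idem A T \<odot>\<^bsub>irr_rep \<nu>\<^esub> h v =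
      path_idem A T0 \<odot>\<^bsub>irr_rep \<nu>\<^esub> (irr_idem (A (Suc n)) \<nu> \<odot>\<^bsub>irr_rep \<nu>\<^esub> h v)"
    using left_moduleD(5)[OF V Suc_mem[OF path_idem_mem[OF T(2)]] level.irr_idem_mem[OF \<nu>] h(1)]
    by (simp add: T(1) path_idem_snoc[OF T(2)])
  also have "\<dots> = h v"
    using level.irr_idem_fixes[OF \<nu>] h v(3) by (simp add: fixes_pointwise_def)
  finally show ?case using h(1,2) T(1) by auto
qed

lemma path_idem_nonzero:
  assumes "T \<in> Tab A n"
  shows "path_idem A T \<noteq> 0"
proof
  assume "path_idem A T = 0"
  moreover have "left_module (A n) (irr_rep (last T))"
    by (rule irreducible_module_left_module[OF level.irr_rep_irreducible[OF last_Tab[OF assms]]])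
  ultimately show False
    using path_idem_fixes_vector[OF assms] level.zero_smult by metis
qed

lemma path_idem_idempotent:
  "T \<in> Tab A n \<Longrightarrow> path_idem A T * path_idem A T = path_idem A T"
proof (induction n arbitrary: T)
  case 0
  then show ?case by (simp add: path_idem_zero)
next
  case (Suc n)
  obtain T0 \<nu> where T: "T = T0 @ [\<nu>]" "T0 \<in> Tab A n" "\<nu> \<in> Irr (A (Suc n))"
    using Suc.prems by (auto elim: Tab_Suc_cases simp: branching_edge_def)
  let ?\<epsilon> = "irr_idem (A (Suc n)) \<nu>"
  have "path_idem A T * path_idem A T = path_idem A T0 * (?\<epsilon> * path_idem A T0) * ?\<epsilon>"
    using T by (simp add: path_idem_snoc mult.assoc)
  also have "\<dots> = (path_idem A T0 * path_idem A T0) * (?\<epsilon> * ?\<epsilon>)"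
    using level.irr_idem_commute[OF T(3) Suc_mem[OF path_idem_mem[OF T(2)]]]
    by (simp add: mult.assoc)
  also have "\<dots> = path_idem A T"
    using Suc.IH[OF T(2)] level.irr_idem_idempotent[OF T(3)] T by (simp add: path_idem_snoc)
  finally show ?case .
qed

text \<open>
  Multiplying the partitions of unity of all levels gives the idempotents of all sequences of
  vertices; those with two consecutive vertices not joined by an edge vanish.
\<close>

lemma sum_path_idem: "(\<Sum>T\<in>Tab A n. path_idem A T) = 1"
proof (induction n)
  case 0
  obtain \<nu> where "Irr (A 0) = {\<nu>}" by (rule Irr_zero)
  then show ?case by (simp add: Tab_zero path_idem_def)
next
  case (Suc n)
  let ?E = "{(T, \<nu>). T \<in> Tab A n \<and> branching_edge A n (last T) \<nu>}"
  have "Tab A (Suc n) = (\<lambda>(T, \<nu>). T @ [\<nu>]) ` ?E"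
    by (force elim!: Tab_Suc_cases simp: snoc_mem_Tab_iff)
  moreover have "inj_on (\<lambda>(T, \<nu>). T @ [\<nu>]) ?E" by (auto simp: inj_on_def)
  ultimately have "(\<Sum>T\<in>Tab A (Suc n). path_idem A T) = (\<Sum>(T, \<nu>)\<in>?E. path_idem A (T @ [\<nu>]))"
    by (simp add: sum.reindex case_prod_unfold)
  also have "\<dots> = (\<Sum>(T, \<nu>)\<in>?E. path_idem A T * irr_idem (A (Suc n)) \<nu>)"
    by (rule sum.cong) (auto simp: path_idem_snoc)
  also have "\<dots> = (\<Sum>(T, \<nu>)\<in>Tab A n \<times> Irr (A (Suc n)). path_idem A T * irr_idem (A (Suc n)) \<nu>)"
  proof (rule sum.mono_neutral_left)
    show "finite (Tab A n \<times> Irr (A (Suc n)))" by (simp add: finite_Tab level.finite_Irr)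
    show "?E \<subseteq> Tab A n \<times> Irr (A (Suc n))" by (auto simp: branching_edge_def)
    show "\<forall>x\<in>Tab A n \<times> Irr (A (Suc n)) - ?E.
        (case x of (T, \<nu>) \<Rightarrow> path_idem A T * irr_idem (A (Suc n)) \<nu>) = 0"
    proof
      fix x assume "x \<in> Tab A n \<times> Irr (A (Suc n)) - ?E"
      then obtain T \<nu> where x: "x = (T, \<nu>)" and T: "T \<in> Tab A n"
        and \<nu>: "\<nu> \<in> Irr (A (Suc n))" and "\<not> branching_edge A n (last T) \<nu>"
        by auto
      then have "irr_idem (A n) (last T) * irr_idem (A (Suc n)) \<nu> = 0"
        using branching_edge_if_product_nonzero[OF last_Tab[OF T] \<nu>] by blast
      then have "path_idem A T * irr_idem (A (Suc n)) \<nu> = 0"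
        using path_idem_mult_last[OF T] by (metis mult.assoc mult_zero_right)
      then show "(case x of (T, \<nu>) \<Rightarrow> path_idem A T * irr_idem (A (Suc n)) \<nu>) = 0"
        by (simp add: x)
    qed
  qed
  also have "\<dots> = (\<Sum>T\<in>Tab A n. path_idem A T) * (\<Sum>\<nu>\<in>Irr (A (Suc n)). irr_idem (A (Suc n)) \<nu>)"
    by (simp add: sum_product sum.cartesian_product)
  finally show ?case using Suc level.sum_irr_idem by simp
qed

section \<open>Contents\<close>

lemma path_expansion_mult:
  assumes "T \<in> Tab A n"
  shows "(\<Sum>S\<in>Tab A n. scale (c S) (path_idem A S)) * path_idem A T = scale (c T) (path_idem A T)"
proof -
  have "(\<Sum>S\<in>Tab A n. scale (c S) (path_idem A S)) * path_idem A T =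
      (\<Sum>S\<in>Tab A n. if S = T then scale (c T) (path_idem A T) else 0)"
    unfolding sum_distrib_right
    by (rule sum.cong[OF refl])
      (auto simp: scale_mult_left path_idem_orthogonal[OF _ assms] path_idem_idempotent[OF assms])
  then show ?thesis using assms by (simp add: finite_Tab)
qed

text \<open>
  The path idempotents sum to \<open>1\<close>, so an element having them as eigenvectors is the combination
  with its eigenvalues as coefficients. Multiplication by a single nonzero path idempotent reads
  off a coefficient, so this combination is the one selected by the description in \<open>jm_content\<close>.
\<close>

lemma jm_content_eq:
  assumes eigen: "\<And>S. S \<in> Tab A n \<Longrightarrow> J k * path_idem A S = scale (c S) (path_idem A S)"
    and T: "T \<in> Tab A n"
  shows "jm_content scale A J n T k = c T"
proof -
  define c0 where "c0 S = (if S \<in> Tab A n then c S else 0)" for S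
  have "J k = J k * (\<Sum>S\<in>Tab A n. path_idem A S)" by (simp add: sum_path_idem)
  also have "\<dots> = (\<Sum>S\<in>Tab A n. scale (c0 S) (path_idem A S))"
    unfolding sum_distrib_left by (rule sum.cong) (simp_all add: eigen c0_def)
  finally have J: "J k = (\<Sum>S\<in>Tab A n. scale (c0 S) (path_idem A S))" .
  have "(THE c. (\<forall>S. S \<notin> Tab A n \<longrightarrow> c S = 0) \<and>
      J k = (\<Sum>S\<in>Tab A n. scale (c S) (path_idem A S))) = c0"
  proof (rule the_equality)
    show "(\<forall>S. S \<notin> Tab A n \<longrightarrow> c0 S = 0) \<and> J k = (\<Sum>S\<in>Tab A n. scale (c0 S) (path_idem A S))"
      using J by (simp add: c0_def)
  next
    fix b assume b: "(\<forall>S. S \<notin> Tab A n \<longrightarrow> b S = 0) \<and> J k = (\<Sum>S\<in>Tab A n. scale (b S) (path_idem A S))"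
    show "b = c0"
    proof
      fix S
      show "b S = c0 S"
      proof (cases "S \<in> Tab A n")
        case True
        then have "scale (b S) (path_idem A S) = scale (c0 S) (path_idem A S)"
          using path_expansion_mult[OF True, of b] path_expansion_mult[OF True, of c0] b J by metis
        then show ?thesis using path_idem_nonzero[OF True] by simp
      next
        case False
        then show ?thesis using b by (simp add: c0_def)
      qed
    qed
  qed
  then show ?thesis unfolding jm_content_def using T by (simp add: c0_def)
qed

text \<open>
  The factor of \<open>path_idem A T\<close> at the last vertex absorbs central elements, so the other vertices
  of the path have no influence on the scalar.
\<close>

lemma center_mult_path_idem:
  assumes z: "z \<in> center (A n)" and T: "T \<in> Tab A n"
    and a: "z * irr_idem (A n) (last T) = scale a (irr_idem (A n) (last T))"
  shows "z * path_idem A T = scale a (path_idem A T)"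
proof -
  have "z * path_idem A T = path_idem A T * z"
    using z path_idem_mem[OF T] unfolding center_def by blast
  also have "\<dots> = path_idem A T * irr_idem (A n) (last T) * z"
    by (simp add: path_idem_mult_last[OF T])
  also have "\<dots> = path_idem A T * (z * irr_idem (A n) (last T))"
    using z level.irr_idem_commute[OF last_Tab[OF T], of z] unfolding center_def
    by (simp add: mult.assoc)
  also have "\<dots> = scale a (path_idem A T)"
    by (simp add: a scale_mult_right path_idem_mult_last[OF T])
  finally show ?thesis .
qed

text \<open>
  With \<open>z k\<close> the \<open>k\<close>-th partial sum of \<open>J\<close>, the last term of \<open>J\<close> is \<open>z (Suc n) - z n\<close>, a difference
  of central elements of consecutive levels. The first acts on a path idempotent by a scalar
  depending on the last vertex, the second by a scalar depending on the last but one.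
\<close>

lemma jm_content_depends_on_types:
  assumes J: "additively_central A J" and T: "T \<in> Tab A (Suc n)" "T' \<in> Tab A (Suc n)"
    and types: "last T = last T'" "last (butlast T) = last (butlast T')"
  shows "jm_content scale A J (Suc n) T (Suc n) = jm_content scale A J (Suc n) T' (Suc n)"
proof -
  define z where "z k = (\<Sum>i=1..k. J i)" for k
  have z: "z k \<in> center (A k)" for k
    \<comment> \<open>The empty sum covers \<open>k = 0\<close>, where additive centrality makes no claim.\<close>
    using J by (cases "k = 0") (simp_all add: z_def additively_central_def center_def[of "A 0"])
  have J_eq: "J (Suc n) = z (Suc n) - z n" by (simp add: z_def)
  obtain a where a: "\<forall>\<nu>\<in>Irr (A (Suc n)).
      z (Suc n) * irr_idem (A (Suc n)) \<nu> = scale (a \<nu>) (irr_idem (A (Suc n)) \<nu>)"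
    using level.center_scalar_irr_idem[OF z] by blast
  obtain b where b: "\<forall>\<mu>\<in>Irr (A n). z n * irr_idem (A n) \<mu> = scale (b \<mu>) (irr_idem (A n) \<mu>)"
    using level.center_scalar_irr_idem[OF z] by blast
  have eigen: "J (Suc n) * path_idem A T =
      scale (a (last T) - b (last (butlast T))) (path_idem A T)" if T: "T \<in> Tab A (Suc n)" for T
  proof -
    obtain T0 \<nu> where T0: "T = T0 @ [\<nu>]" "T0 \<in> Tab A n" using T by (rule Tab_Suc_cases)
    have "z (Suc n) * path_idem A T = scale (a (last T)) (path_idem A T)"
      by (rule center_mult_path_idem[OF z T bspec[OF a last_Tab[OF T]]])
    moreover have "z n * path_idem A T0 = scale (b (last T0)) (path_idem A T0)"
      by (rule center_mult_path_idem[OF z T0(2) bspec[OF b last_Tab[OF T0(2)]]])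
    then have "z n * path_idem A T = scale (b (last (butlast T))) (path_idem A T)"
      by (simp add: T0(1) path_idem_snoc[OF T0(2)] scale_mult_left flip: mult.assoc)
    ultimately show ?thesis
      by (simp add: J_eq left_diff_distrib scale_left_diff_distrib)
  qed
  have "jm_content scale A J (Suc n) T (Suc n) = a (last T) - b (last (butlast T))"
    if "T \<in> Tab A (Suc n)" for T
    by (rule jm_content_eq[where c = "\<lambda>T. a (last T) - b (last (butlast T))"])
      (rule eigen, assumption, rule that)
  then show ?thesis using T types by simp
qed

lemma replace_trunc_mem_Tab:
  assumes "S \<in> Tab A (Suc n)" "T \<in> Tab A (Suc n)" "last (butlast S) = last (butlast T)"
  shows "butlast T @ [last S] \<in> Tab A (Suc n)"
  using assms by (auto elim!: Tab_Suc_cases simp: snoc_mem_Tab_iff)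

text \<open>
  The factors of the two products correspond by exchanging the truncations \<open>butlast T\<close> and
  \<open>butlast T'\<close>: they end in the same vertex, so they have the same extensions, and corresponding
  extensions have the same types and thus equal contents.
\<close>

lemma content_poly_depends_on_types:
  assumes J: "additively_central A J" and T: "T \<in> Tab A (Suc n)" "T' \<in> Tab A (Suc n)"
    and types: "last T = last T'" "last (butlast T) = last (butlast T')"
  shows "content_poly scale A J (Suc n) T = content_poly scale A J (Suc n) T'"
proof -
  have snoc: "butlast S @ [last S] = S" if "S \<in> Tab A (Suc n)" for S
    using Tab_nonempty[OF that] by simp
  show ?thesis
    unfolding content_poly_def
  proof (rule prod.reindex_bij_witness[where j = "\<lambda>S. butlast T' @ [last S]"
        and i = "\<lambda>S. butlast T @ [last S]"])
    fix S assume S: "S \<in> {S \<in> Tab A (Suc n). S \<noteq> T \<and> butlast S = butlast T}"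
    then show "butlast T @ [last (butlast T' @ [last S])] = S"
      using snoc[of S] by simp
    have "last S \<noteq> last T" using S snoc[of S] snoc[OF T(1)] by auto
    moreover have mem: "butlast T' @ [last S] \<in> Tab A (Suc n)"
      using replace_trunc_mem_Tab[of S n T'] S T types by simp
    ultimately show "butlast T' @ [last S] \<in> {S \<in> Tab A (Suc n). S \<noteq> T' \<and> butlast S = butlast T'}"
      using types by (metis (mono_tags, lifting) butlast_snoc last_snoc mem_Collect_eq)
    have "jm_content scale A J (Suc n) (butlast T' @ [last S]) (Suc n) = jm_content scale A J (Suc n) S (Suc n)"
      using jm_content_depends_on_types[OF J mem, of S] S types T by simp
    moreover have "jm_content scale A J (Suc n) T' (Suc n) = jm_content scale A J (Suc n) T (Suc n)"
      using jm_content_depends_on_types[OF J T types] by simp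
    ultimately show "Polynomial.smult (1 / (jm_content scale A J (Suc n) T' (Suc n) -
          jm_content scale A J (Suc n) (butlast T' @ [last S]) (Suc n)))
        [:- jm_content scale A J (Suc n) (butlast T' @ [last S]) (Suc n), 1:] =
      Polynomial.smult (1 / (jm_content scale A J (Suc n) T (Suc n) - jm_content scale A J (Suc n) S (Suc n)))
        [:- jm_content scale A J (Suc n) S (Suc n), 1:]" by simp
  next
    fix S assume S: "S \<in> {S \<in> Tab A (Suc n). S \<noteq> T' \<and> butlast S = butlast T'}"
    then show "butlast T' @ [last (butlast T @ [last S])] = S"
      using snoc[of S] by simp
    have "last S \<noteq> last T'" using S snoc[of S] snoc[OF T(2)] by auto
    moreover have "butlast T @ [last S] \<in> Tab A (Suc n)"
      using replace_trunc_mem_Tab[of S n T] S T types by simp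
    ultimately show "butlast T @ [last S] \<in> {S \<in> Tab A (Suc n). S \<noteq> T \<and> butlast S = butlast T}"
      using types by (metis (mono_tags, lifting) butlast_snoc last_snoc mem_Collect_eq)
  qed
qed

end

theorem lemma3p9:
  fixes scale :: "'k::field \<Rightarrow> 'a::ring_1 \<Rightarrow> 'a"
    and A :: "nat \<Rightarrow> 'a set"
    and J :: "nat \<Rightarrow> 'a"
    and n :: nat
    and T T' :: "'a path"
  assumes "multiplicity_free_family scale A"
    and "JM_sequence scale A J"
    and "1 \<le> n"
    and "T \<in> Tab A n"
    and "T' \<in> Tab A n"
    and "path_type T = path_type T'"
    and "path_type (path_trunc T) = path_type (path_trunc T')"
  shows "jm_content scale A J n T n = jm_content scale A J n T' n \<and>
    content_poly scale A J n T = content_poly scale A J n T' \<and>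
    eval_poly_in scale (content_poly scale A J n T) (J n) =
      eval_poly_in scale (content_poly scale A J n T') (J n)"
proof -
  interpret multiplicity_free_family scale A by fact
  have J: "additively_central A J"
    using assms(2) by (simp add: JM_sequence_def)
  obtain m where n: "n = Suc m" using assms(3) by (cases n) simp_all
  have "jm_content scale A J n T n = jm_content scale A J n T' n"
    using jm_content_depends_on_types[OF J] assms(4-7) unfolding n by blast
  moreover have "content_poly scale A J n T = content_poly scale A J n T'"
    using content_poly_depends_on_types[OF J] assms(4-7) unfolding n by blast
  ultimately show ?thesis by simp
qed

end
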